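(* Let $q=2^m$ with $m\ge 2$ and let $S\subset(\mathbb{Z}/q\mathbb{Z})^\times$. Then there exists a constant $K(q,S)\in(0,\infty)$ such that $$P_S(x)=K(q,S)\,(\log x)^{-2\mu(S)/\varphi(q)}\,(1+o(1)),\qquad x\to\infty.$$
   Context: Throughout, $p$ denotes an odd prime. The function $\chi_4$ is given on odd integers by $\chi_4(n)=1$ if $n\equiv 1\pmod 4$ and $\chi_4(n)=-1$ if $n\equiv 3\pmod 4$. For an odd prime $p$ set $A(p)=\dfrac{p-\chi_4(p)}{p+\chi_4(p)}$. Here $(\mathbb{Z}/q\mathbb{Z})^\times$ is the group of reduced residue classes modulo $q$ and $\varphi$ is Euler's totient function. Since $4\mid q$, each $a\in(\mathbb{Z}/q\mathbb{Z})^\times$ has a well-defined value $\chi_4(a)\in\{\pm1\}$. For $S\subset(\mathbb{Z}/q\mathbb{Z})^\times$ define $$P_S(x)=\prod_{\substack{p\le x\\ p\bmod q\in S}}A(p),\qquad \mu(S)=\sum_{a\in S}\chi_4(a).$$ *)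

theory Defs
  imports "HOL-Number_Theory.Number_Theory" "HOL-Library.Landau_Symbols"
begin

text \<open>The value 0 on even arguments is a dummy: only odd arguments matter.\<close>

definition chi4 :: "int \<Rightarrow> int" where
  "chi4 n = (if [n = 1] (mod 4) then 1 else if [n = 3] (mod 4) then -1 else 0)"

definition prime_quot :: "nat \<Rightarrow> real" where
  "prime_quot p = (real p - of_int (chi4 (int p))) / (real p + of_int (chi4 (int p)))"

text \<open>
  Residue classes modulo \<open>q\<close> are represented by integers in \<open>{0..q - 1}\<close>, as in
  \<^const>\<open>residue_ring\<close>; so \<open>S\<close> is meant to be a subset of
  \<open>Units (residue_ring (int q))\<close>.
\<close>

definition P_prod :: "nat \<Rightarrow> int set \<Rightarrow> real \<Rightarrow> real" where
  "P_prod q S x = (\<Prod>p | prime p \<and> odd p \<and> real p \<le> x \<and> int p mod int q \<in> S. prime_quot p)"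

definition mu :: "int set \<Rightarrow> int" where
  "mu S = (\<Sum>a\<in>S. chi4 a)"

end

theory Submission
  imports Defs "HOL-Computational_Algebra.Squarefree"
begin

text \<open>
  Since \<open>ln A(p) = - 2 * chi4 p / p + O(1 / p^2)\<close>, the logarithm of the product is, up to a
  convergent series, a linear combination of the sums of \<open>1 / p\<close> over the primes in the single
  residue classes of \<open>S\<close>. Each of these sums equals \<open>ln (ln x) / totient q\<close> plus a constant plus
  \<open>o(1)\<close>: this is Mertens' second theorem for primes in progressions
  (\<open>mertens_second_progression\<close>). Weighting the classes by \<^const>\<open>chi4\<close> turns the coefficient into
  \<open>- 2 * mu S / totient q\<close>, and exponentiating gives the claim with a positive constant.

  The theorem on progressions is proved by elementary means. Partial summation
  (\<open>partial_summation_ln\<close>) reduces it to the estimate \<open>ln N / totient q + O(1)\<close> for the sum of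
  \<open>\<Lambda>(n) / n\<close> over \<open>n \<le> N\<close> in a fixed class, \<open>\<Lambda>\<close> being von Mangoldt's function; the proper prime
  powers contribute only \<open>O(1)\<close>. Orthogonality of the Dirichlet characters modulo \<open>q\<close> splits that
  sum into the sums \<open>M\<^sub>\<chi>(N)\<close> of \<open>\<chi>(n) * \<Lambda>(n) / n\<close>. The principal character gives
  \<open>ln N + O(1)\<close>, by Chebyshev's bound and Mertens' first theorem. For every other character,
  \<open>M\<^sub>\<chi>\<close> is bounded if \<open>L(1, \<chi>) \<noteq> 0\<close> (\<open>twisted_mangoldt_bounded\<close>), and equals \<open>- ln N + O(1)\<close> if
  \<open>L(1, \<chi>) = 0\<close> (\<open>twisted_mangoldt_if_L1_zero\<close>, an argument of Shapiro).

  So everything depends on \<open>L(1, \<chi>) \<noteq> 0\<close>. In the class of \<open>1\<close> the sum of \<open>\<Lambda>(n) / n\<close> is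
  nonnegative and is proportional to \<open>(1 - z) * ln N + O(1)\<close>, where \<open>z\<close> counts the characters with
  \<open>L(1, \<chi>) = 0\<close>; hence \<open>z \<le> 1\<close>. As \<open>\<chi>\<close> and its conjugate vanish together, a
  character with \<open>L(1, \<chi>) = 0\<close> is real. A real character modulo a power of two depends only on the
  argument modulo 8, because 5 generates the classes that are 1 modulo 4 and \<open>\<chi>(5)^2 = 1\<close>. This
  leaves three sign patterns, and in each of them the terms of \<open>L(1, \<chi>)\<close>, taken in blocks of
  length 8, have nonnegative sums, the first of which is positive.
\<close>

section \<open>Chebyshev and Mertens estimates\<close>

text \<open>
  Both sides run over the pairs \<open>(d, k)\<close> with \<open>d * k \<le> N\<close>. The convolution identities for
  sums up to \<open>N\<close> all come from this rearrangement.
\<close>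

lemma sum_divisors_swap:
  fixes F :: "nat \<Rightarrow> nat \<Rightarrow> 'a::comm_monoid_add"
  shows "(\<Sum>n=1..N. \<Sum>d | d dvd n. F d (n div d)) = (\<Sum>d=1..N. \<Sum>k=1..N div d. F d k)"
proof -
  have "(\<Sum>n=1..N. \<Sum>d | d dvd n. F d (n div d))
      = (\<Sum>(n,d)\<in>Sigma {1..N} (\<lambda>n. {d. d dvd n}). F d (n div d))"
    by (subst sum.Sigma) (auto)
  also have "\<dots> = (\<Sum>(d,k)\<in>Sigma {1..N} (\<lambda>d. {1..N div d}). F d k)"
  proof (rule sum.reindex_bij_witness[of _ "\<lambda>(d,k). (d*k, d)" "\<lambda>(n,d). (d, n div d)"], goal_cases)
    case (2 a)
    then obtain n d where a: "a = (n, d)" "1 \<le> n" "n \<le> N" "d dvd n" by auto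
    then show ?case
      by (auto simp: div_le_mono Suc_le_eq div_greater_zero_iff dest: dvd_imp_le
          intro: le_trans[OF dvd_imp_le] Nat.gr0I)
  next
    case (4 b)
    then show ?case
      by (auto simp: Suc_le_eq less_eq_div_iff_mult_less_eq mult.commute)
  qed auto
  also have "\<dots> = (\<Sum>d=1..N. \<Sum>k=1..N div d. F d k)"
    by (subst sum.Sigma) (auto)
  finally show ?thesis .
qed

text \<open>
  Legendre's formula for \<open>ln N!\<close>, from \<open>ln n = (\<Sum>d | d dvd n. \<Lambda>(d))\<close>. Comparing it with the
  growth of \<open>ln N!\<close> is the source of all information about the average size of \<open>\<Lambda>\<close>.
\<close>

lemma sum_ln_eq_sum_mangoldt:
  "(\<Sum>n=1..N. ln (real n)) = (\<Sum>d=1..N. mangoldt d * real (N div d))"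
proof -
  have "(\<Sum>n=1..N. ln (real n)) = (\<Sum>n=1..N. \<Sum>d | d dvd n. mangoldt d)"
    by (intro sum.cong) (auto simp: mangoldt_sum)
  also have "\<dots> = (\<Sum>d=1..N. \<Sum>k=1..N div d. mangoldt d)"
    by (rule sum_divisors_swap[of "\<lambda>d k. mangoldt d"])
  finally show ?thesis by (simp add: mult.commute)
qed

lemma ln_fact_sum: "ln (fact N :: real) = (\<Sum>n=1..N. ln (real n))"
  unfolding fact_prod of_nat_id by (subst of_nat_prod, subst ln_prod) auto

text \<open>
  Half of a crude Stirling formula. An error linear in \<open>N\<close> is small enough because the estimate is
  always divided by \<open>N\<close> in the end.
\<close>

lemma sum_ln_lower: "real N * ln (real N) - real N \<le> (\<Sum>n=1..N. ln (real n))"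
proof (induction N)
  case (Suc N)
  show ?case
  proof (cases "N = 0")
    case False
    have "ln (real (Suc N)) - ln (real N) = ln (1 + 1 / real N)"
      using False by (subst ln_divide_pos[symmetric]) (auto simp: field_simps)
    also have "\<dots> \<le> 1 / real N" using False by (intro ln_add_one_self_le_self) auto
    finally have "real N * (ln (real (Suc N)) - ln (real N)) \<le> 1"
      using False by (simp add: field_simps)
    then show ?thesis using Suc by (simp add: algebra_simps)
  qed simp
qed simp

lemma sum_ln_upper: "(\<Sum>n=1..N. ln (real n)) \<le> real N * ln (real N)"
proof -
  have "(\<Sum>n=1..N. ln (real n)) \<le> (\<Sum>n=1..N. ln (real N))"
    by (intro sum_mono) auto
  then show ?thesis by simp
qed

definition chebyshev_psi :: "nat \<Rightarrow> real" where
  "chebyshev_psi N = (\<Sum>n=1..N. mangoldt n)"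

text \<open>
  Chebyshev's argument. In \<open>ln (2 * n choose n)\<close>, expanded by Legendre's formula, the weight of
  \<open>\<Lambda>(d)\<close> is \<open>\<lfloor>2 * n / d\<rfloor> - 2 * \<lfloor>n / d\<rfloor>\<close>; it is never negative, and it is 1 for \<open>n < d \<le> 2 * n\<close>.
  On the other side, \<open>ln (2 * n choose n) \<le> n * ln 4\<close>.
\<close>

lemma chebyshev_psi_double: "chebyshev_psi (2 * n) \<le> chebyshev_psi n + real n * ln 4"
proof -
  have le: "(2 * n choose n) \<le> 2 ^ (2 * n)"
    using binomial_le_pow2 by blast
  have pos: "real (2 * n choose n) > 0" by simp
  have "chebyshev_psi (2 * n) - chebyshev_psi n = (\<Sum>d\<in>{n<..2*n}. mangoldt d)"
  proof -
    have "{1..2*n} = {1..n} \<union> {n<..2*n}" by auto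
    then show ?thesis unfolding chebyshev_psi_def
      by (simp only:, subst sum.union_disjoint) auto
  qed
  also have "\<dots> \<le> (\<Sum>d\<in>{n<..2*n}. mangoldt d * (real ((2*n) div d) - 2 * real (n div d)))"
  proof (rule sum_mono)
    fix d assume d: "d \<in> {n<..2*n}"
    then have "n div d = 0" "(2*n) div d \<ge> 1" by (auto simp: Suc_le_eq div_greater_zero_iff)
    then show "mangoldt d \<le> (mangoldt d :: real) * (real ((2*n) div d) - 2 * real (n div d))"
      using mult_left_mono[OF _ mangoldt_nonneg, of 1 "real ((2*n) div d)" d] by simp
  qed
  also have "\<dots> \<le> (\<Sum>d=1..2*n. mangoldt d * (real ((2*n) div d) - 2 * real (n div d)))"
  proof (rule sum_mono2)
    fix d assume "d \<in> {1..2*n} - {n<..2*n}"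
    have "2 * (n div d) \<le> (2*n) div d"
    proof (cases "d = 0")
      case False
      have "2 * (n div d) * d \<le> 2 * n" by (simp add: mult.assoc)
      then show ?thesis using False by (simp add: less_eq_div_iff_mult_less_eq)
    qed simp
    then have "2 * real (n div d) \<le> real ((2*n) div d)"
      by (metis of_nat_le_iff of_nat_mult of_nat_numeral)
    then show "0 \<le> mangoldt d * (real ((2*n) div d) - 2 * real (n div d))"
      by (intro mult_nonneg_nonneg mangoldt_nonneg) auto
  qed auto
  also have "\<dots> = (\<Sum>d=1..2*n. mangoldt d * real ((2*n) div d))
      - 2 * (\<Sum>d=1..2*n. mangoldt d * real (n div d))"
    by (simp add: right_diff_distrib sum_subtractf sum_distrib_left mult_ac)
  also have "(\<Sum>d=1..2*n. mangoldt d * real (n div d)) = (\<Sum>d=1..n. mangoldt d * real (n div d))"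
    by (intro sum.mono_neutral_right) auto
  also have "(\<Sum>d=1..2*n. mangoldt d * real ((2*n) div d)) - 2 * \<dots>
      = ln (fact (2*n) :: real) - 2 * ln (fact n :: real)"
    by (simp only: ln_fact_sum sum_ln_eq_sum_mangoldt)
  also have "\<dots> = ln (real (2 * n choose n))"
    by (simp add: binomial_fact ln_div ln_mult power2_eq_square)
  also have "\<dots> \<le> ln (real (2 ^ (2 * n)))"
    using le pos by (subst ln_le_cancel_iff) (auto simp del: of_nat_power)
  also have "\<dots> = real n * ln 4"
    by (simp add: ln_realpow power_mult)
  finally show ?thesis by simp
qed

lemma chebyshev_psi_Suc_le: "chebyshev_psi (Suc n) \<le> chebyshev_psi n + real (Suc n)"
proof -
  have "mangoldt (Suc n) \<le> ln (real (Suc n))" by (rule mangoldt_le) auto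
  also have "\<dots> \<le> real (Suc n) - 1" by (rule ln_le_minus_one) auto
  finally show ?thesis by (simp add: chebyshev_psi_def)
qed

text \<open>
  By halving \<open>N\<close>. The constant only has to survive the recursion: with \<open>ln 4 \<le> 3\<close> and
  \<open>\<Lambda>(N) \<le> N\<close> for the last term when \<open>N\<close> is odd, any constant that is at least 5 does.
\<close>

theorem chebyshev_psi_upper: "chebyshev_psi N \<le> 6 * real N"
proof (induction N rule: less_induct)
  case (less N)
  show ?case
  proof (cases "N = 0")
    case False
    define n where "n = N div 2"
    have "n < N" using False by (auto simp: n_def)
    then have IH: "chebyshev_psi n \<le> 6 * real n" using less by blast
    have l4: "ln 4 \<le> (3::real)" using ln_le_minus_one[of "4::real"] by simp
    have "real n * ln 4 \<le> real n * 3" using l4 by (intro mult_left_mono) auto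
    then have d: "chebyshev_psi (2*n) \<le> 9 * real n"
      using chebyshev_psi_double[of n] IH by simp
    show ?thesis
    proof (cases "even N")
      case True
      then have "N = 2 * n" by (simp add: n_def)
      then show ?thesis using d by simp
    next
      case odd: False
      then have N: "N = Suc (2 * n)" by (simp add: n_def)
      then show ?thesis using d chebyshev_psi_Suc_le[of "2*n"] by simp
    qed
  qed (simp add: chebyshev_psi_def)
qed

lemma of_nat_div_ge: "real n / real d - 1 \<le> real (n div d)"
proof (cases "d = 0")
  case False
  have "real n = real (n div d) * real d + real (n mod d)"
    by (metis div_mult_mod_eq of_nat_add of_nat_mult)
  moreover have "real (n mod d) \<le> real d" using False by (simp add: less_imp_le)
  ultimately show ?thesis using False by (simp add: field_simps)
qed simp

text \<open>
  Dropping the floors in Legendre's formula replaces \<open>ln N!\<close> by \<open>N\<close> times the sum, at the price of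
  an error of at most \<open>\<psi>(N) \<le> 6 * N\<close>; and \<open>ln N!\<close> is \<open>N * ln N\<close> up to \<open>N\<close>.
\<close>

theorem mertens_first: "\<bar>(\<Sum>n=1..N. mangoldt n / real n) - ln (real N)\<bar> \<le> 7"
proof (cases "N = 0")
  case False
  define S where "S = (\<Sum>n=1..N. mangoldt n / real n :: real)"
  define T where "T = (\<Sum>n=1..N. ln (real n))"
  have T: "T = (\<Sum>d=1..N. mangoldt d * real (N div d))"
    unfolding T_def by (rule sum_ln_eq_sum_mangoldt)
  have up: "T \<le> real N * S" unfolding T S_def sum_distrib_left
  proof (rule sum_mono)
    fix d assume "d \<in> {1..N}"
    have "mangoldt d * real (N div d) \<le> mangoldt d * (real N / real d)"
      by (intro mult_left_mono mangoldt_nonneg of_nat_div_le_of_nat)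
    then show "mangoldt d * real (N div d) \<le> real N * (mangoldt d / real d)"
      by (simp add: mult.commute)
  qed
  have "real N * S - chebyshev_psi N \<le> T"
    unfolding T S_def sum_distrib_left chebyshev_psi_def sum_subtractf[symmetric]
  proof (rule sum_mono)
    fix d assume d: "d \<in> {1..N}"
    have "mangoldt d * (real N / real d - 1) \<le> mangoldt d * real (N div d)"
      by (intro mult_left_mono mangoldt_nonneg of_nat_div_ge)
    then show "real N * (mangoldt d / real d) - mangoldt d \<le> mangoldt d * real (N div d)"
      by (simp add: field_simps)
  qed
  then have lo: "real N * S - 6 * real N \<le> T" using chebyshev_psi_upper[of N] by linarith
  have N: "real N > 0" using False by simp
  have "real N * S \<le> real N * (ln (real N) + 6)"
    using lo sum_ln_upper[of N] by (simp add: T_def algebra_simps)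
  moreover have "real N * (ln (real N) - 1) \<le> real N * S"
    using up sum_ln_lower[of N] by (simp add: T_def algebra_simps)
  ultimately have "S \<le> ln (real N) + 6" "ln (real N) - 1 \<le> S" using N by auto
  then show ?thesis unfolding S_def[symmetric] by linarith
qed simp

section \<open>The Moebius function\<close>

definition moebius :: "nat \<Rightarrow> real" where
  "moebius n = (if squarefree n then (-1) ^ card (prime_factors n) else 0)"

lemma moebius_1 [simp]: "moebius (Suc 0) = 1"
  by (simp add: moebius_def)

lemma abs_moebius_le: "\<bar>moebius n\<bar> \<le> 1"
  by (simp add: moebius_def power_abs)

lemma moebius_prime_mult:
  assumes "prime p" "\<not> p dvd n" "n > 0"
  shows "moebius (p * n) = - moebius n"
proof -
  have cop: "coprime p n" using assms by (simp add: prime_imp_coprime)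
  have "squarefree (p * n) \<longleftrightarrow> squarefree n"
    using cop assms(1) by (metis squarefree_mult_coprime squarefree_prime squarefree_mono dvd_triv_right)
  moreover have "prime_factors (p * n) = insert p (prime_factors n)"
    using assms by (simp add: prime_factors_product prime_prime_factors)
  moreover have "p \<notin> prime_factors n" using assms by auto
  ultimately show ?thesis by (simp add: moebius_def)
qed

text \<open>
  For a prime \<open>p\<close> dividing \<open>n\<close>, the squarefree divisors come in pairs \<open>d\<close>, \<open>p * d\<close> with opposite
  signs, so the sum cancels as soon as such a \<open>p\<close> exists.
\<close>

theorem sum_moebius_divisors:
  assumes "n > 0"
  shows "(\<Sum>d | d dvd n. moebius d) = (if n = 1 then 1 else 0)"
proof (cases "n = 1")
  case False
  then obtain p where p: "prime p" "p dvd n" by (metis prime_factor_nat)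
  define A where "A = {d. d dvd n \<and> squarefree d \<and> \<not> p dvd d}"
  define B where "B = {d. d dvd n \<and> squarefree d \<and> p dvd d}"
  have fin: "finite A" "finite B" using assms
    by (auto simp: A_def B_def intro: finite_subset[OF _ finite_divisors_nat])
  have "(\<Sum>d | d dvd n. moebius d) = (\<Sum>d\<in>A \<union> B. moebius d)"
    using assms by (intro sum.mono_neutral_right) (auto simp: A_def B_def moebius_def)
  also have "\<dots> = (\<Sum>d\<in>A. moebius d) + (\<Sum>d\<in>B. moebius d)"
    using fin by (intro sum.union_disjoint) (auto simp: A_def B_def)
  also have "(\<Sum>d\<in>B. moebius d) = (\<Sum>d\<in>A. moebius (p * d))"
  proof (rule sum.reindex_bij_witness[of _ "\<lambda>d. p * d" "\<lambda>d. d div p"])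
    fix d assume d: "d \<in> B"
    then have eq: "p * (d div p) = d" by (simp add: B_def)
    then show "p * (d div p) = d" "moebius (p * (d div p)) = moebius d" by auto
    have "\<not> p dvd d div p"
    proof
      assume "p dvd d div p"
      then have "p ^ 2 dvd p * (d div p)" by (simp add: power2_eq_square)
      then have "p ^ 2 dvd d" using eq by simp
      then have "is_unit p" using d by (auto simp: B_def squarefree_def)
      then show False using p by auto
    qed
    moreover have "d div p dvd d" using eq by (metis dvd_triv_right)
    ultimately show "d div p \<in> A" using d
      by (auto simp: A_def B_def intro: dvd_trans squarefree_mono)
  next
    fix d assume d: "d \<in> A"
    show "(p * d) div p = d" using p by (simp add: prime_gt_0_nat)
    have cop: "coprime p d" using d p by (auto simp: A_def intro: prime_imp_coprime)
    then have "p * d dvd n" using p d by (auto simp: A_def intro: divides_mult)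
    moreover have "squarefree (p * d)" using squarefree_mult_coprime[OF cop squarefree_prime] d p
      by (simp add: A_def)
    ultimately show "p * d \<in> B" by (auto simp: B_def)
  qed
  also have "\<dots> = (\<Sum>d\<in>A. - moebius d)"
    using p assms by (intro sum.cong refl moebius_prime_mult) (auto simp: A_def intro: Nat.gr0I)
  finally show ?thesis using False by (simp add: sum_negf)
qed simp

lemma sum_divisors_nested_swap:
  fixes F :: "nat \<Rightarrow> nat \<Rightarrow> 'a::comm_monoid_add"
  assumes "n > 0"
  shows "(\<Sum>d | d dvd n. \<Sum>e | e dvd n div d. F d e) = (\<Sum>e | e dvd n. \<Sum>d | d dvd n div e. F d e)"
proof -
  have *: "(d dvd n \<and> e dvd n div d) \<longleftrightarrow> (d * e dvd n)" for d e
    using assms by (cases "d = 0") (auto simp: dvd_div_iff_mult mult.commute dest: dvd_mult_left dvd_mult_right)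
  have **: "(d dvd n \<and> e dvd n div d) \<longleftrightarrow> (e dvd n \<and> d dvd n div e)" for d e
    by (simp only: *) (simp add: mult.commute)
  have "(\<Sum>d | d dvd n. \<Sum>e | e dvd n div d. F d e)
      = (\<Sum>(d,e)\<in>Sigma {d. d dvd n} (\<lambda>d. {e. e dvd n div d}). F d e)"
    using assms by (subst sum.Sigma) (auto intro!: finite_divisors_nat elim!: dvdE)
  also have "\<dots> = (\<Sum>(e,d)\<in>Sigma {e. e dvd n} (\<lambda>e. {d. d dvd n div e}). F d e)"
    by (rule sum.reindex_bij_witness[of _ prod.swap prod.swap])
       (use ** in auto)
  also have "\<dots> = (\<Sum>e | e dvd n. \<Sum>d | d dvd n div e. F d e)"
    using assms by (subst sum.Sigma) (auto intro!: finite_divisors_nat elim!: dvdE)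
  finally show ?thesis .
qed

text \<open>
  Moebius inversion of \<open>ln n = (\<Sum>d | d dvd n. \<Lambda>(d))\<close> gives \<open>\<Lambda>(n)\<close> as the sum of
  \<open>moebius d * ln (n / d)\<close>. The part with \<open>ln n\<close> vanishes: for \<open>n > 1\<close> by
  \<open>sum_moebius_divisors\<close>, for \<open>n = 1\<close> because \<open>ln 1 = 0\<close>.
\<close>

theorem sum_moebius_ln:
  assumes "n > 0"
  shows "(\<Sum>d | d dvd n. moebius d * ln (real d)) = - mangoldt n"
proof -
  have ln: "(\<Sum>d | d dvd n. moebius d * ln (real n)) = 0"
    using sum_moebius_divisors[OF assms] by (auto simp flip: sum_distrib_right)
  have "mangoldt n = (\<Sum>e | e dvd n. mangoldt e * (\<Sum>d | d dvd n div e. moebius d))"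
  proof -
    have "(\<Sum>e | e dvd n. mangoldt e * (\<Sum>d | d dvd n div e. moebius d))
        = (\<Sum>e | e dvd n. if e = n then mangoldt e else 0)"
    proof (intro sum.cong refl, goal_cases)
      case (1 e)
      then obtain k where k: "n = e * k" by auto
      then have "e > 0" "k > 0" using assms by auto
      then show ?case by (auto simp: k sum_moebius_divisors)
    qed
    also have "\<dots> = mangoldt n" using assms by (subst sum.delta) auto
    finally show ?thesis by simp
  qed
  also have "\<dots> = (\<Sum>e | e dvd n. \<Sum>d | d dvd n div e. moebius d * mangoldt e)"
    by (simp add: sum_distrib_left mult.commute)
  also have "\<dots> = (\<Sum>d | d dvd n. \<Sum>e | e dvd n div d. moebius d * mangoldt e)"
    using sum_divisors_nested_swap[OF assms, of "\<lambda>d e. moebius d * mangoldt e"] by simp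
  also have "\<dots> = (\<Sum>d | d dvd n. moebius d * (ln (real n) - ln (real d)))"
  proof (intro sum.cong refl, goal_cases)
    case (1 d)
    then obtain k where k: "n = d * k" by auto
    then have "d > 0" "k > 0" using assms by auto
    then show ?case
      by (simp add: k mangoldt_sum ln_mult flip: sum_distrib_left)
  qed
  also have "\<dots> = - (\<Sum>d | d dvd n. moebius d * ln (real d))"
    using ln by (simp add: right_diff_distrib sum_subtractf)
  finally show ?thesis by simp
qed

section \<open>Dirichlet characters and their value at one\<close>

text \<open>
  Summation by parts: bounded partial sums of \<open>a\<close> are compensated by the total variation of \<open>f\<close>,
  which is \<open>f M - f N\<close> for a decreasing \<open>f\<close>; the two boundary terms contribute the rest.
\<close>

theorem abel_tail_bound:
  fixes a :: "nat \<Rightarrow> 'a::real_normed_field" and f :: "nat \<Rightarrow> real"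
  assumes bound: "\<And>N. norm (\<Sum>n<N. a n) \<le> B"
    and dec: "\<And>n. n \<ge> M \<Longrightarrow> f (Suc n) \<le> f n"
    and nonneg: "\<And>n. n \<ge> M \<Longrightarrow> f n \<ge> 0"
    and MN: "M \<le> N"
  shows "norm (\<Sum>n=M..<N. a n * of_real (f n)) \<le> 2 * B * f M"
proof -
  define A where "A N = (\<Sum>n<N. a n)" for N
  have parts: "(\<Sum>n=M..<N. a n * of_real (f n)) =
      A N * of_real (f N) - A M * of_real (f M) + (\<Sum>n=M..<N. A (Suc n) * of_real (f n - f (Suc n)))"
    using MN
  proof (induction N rule: dec_induct)
    case (step n)
    then show ?case by (simp add: A_def algebra_simps)
  qed simp
  have B: "norm (A n) \<le> B" for n using bound by (simp add: A_def)
  have "norm (\<Sum>n=M..<N. A (Suc n) * of_real (f n - f (Suc n))) \<le> (\<Sum>n=M..<N. B * (f n - f (Suc n)))"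
  proof (rule sum_norm_le)
    fix n assume "n \<in> {M..<N}"
    then have "f n - f (Suc n) \<ge> 0" using dec by auto
    then show "norm (A (Suc n) * of_real (f n - f (Suc n))) \<le> B * (f n - f (Suc n))"
      using B by (simp add: norm_mult mult_right_mono del: of_real_diff)
  qed
  also have "\<dots> = B * (f M - f N)"
    unfolding sum_distrib_left[symmetric] using MN
    by (simp add: sum_Suc_diff' [of M N "\<lambda>n. - f n", simplified])
  finally have 1: "norm (\<Sum>n=M..<N. A (Suc n) * of_real (f n - f (Suc n))) \<le> B * (f M - f N)" .
  have 2: "norm (A k * of_real (f k)) \<le> B * f k" if "k \<ge> M" for k
    using B nonneg[OF that] by (simp add: norm_mult mult_right_mono)
  have "norm (\<Sum>n=M..<N. a n * of_real (f n)) \<le> norm (A N * of_real (f N)) + norm (A M * of_real (f M))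
      + norm (\<Sum>n=M..<N. A (Suc n) * of_real (f n - f (Suc n)))"
    unfolding parts by (intro norm_triangle_le add_mono norm_triangle_le_diff order_refl)
  also have "\<dots> \<le> B * f N + B * f M + B * (f M - f N)"
    using 1 2 MN by (intro add_mono) auto
  finally show ?thesis by (simp add: algebra_simps)
qed

text \<open>
  Characters live on all natural numbers and vanish exactly off the units. This makes
  multiplicativity unconditional, forces \<open>\<chi> 1 = 1\<close>, and lets equality of characters be plain equality
  of functions.
\<close>

locale dirichlet_character =
  fixes q :: nat and \<chi> :: "nat \<Rightarrow> complex"
  assumes q_pos: "q > 0"
    and mult: "\<chi> (a * b) = \<chi> a * \<chi> b"
    and periodic: "\<chi> (n + q) = \<chi> n"
    and nonzero_iff: "\<chi> n \<noteq> 0 \<longleftrightarrow> coprime n q"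
begin

lemma one [simp]: "\<chi> (Suc 0) = 1"
  using mult[of 1 1] nonzero_iff[of 1] by auto

lemma power: "\<chi> (a ^ k) = \<chi> a ^ k"
  by (induction k) (auto simp: mult)

lemma periodic_mult: "\<chi> (n + k * q) = \<chi> n"
proof (induction k)
  case (Suc k)
  have "\<chi> (n + Suc k * q) = \<chi> (n + k * q + q)" by (simp add: algebra_simps)
  then show ?case using Suc periodic by simp
qed simp

lemma mod_eq [simp]: "\<chi> (n mod q) = \<chi> n"
  using periodic_mult[of "n mod q" "n div q"] by simp

lemma cong: "[a = b] (mod q) \<Longrightarrow> \<chi> a = \<chi> b"
  by (metis cong_def mod_eq)

lemma norm_eq_1: "coprime n q \<Longrightarrow> norm (\<chi> n) = 1"
proof -
  assume "coprime n q"
  then have "[n ^ totient q = 1] (mod q)" by (rule euler_theorem)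
  then have "\<chi> n ^ totient q = 1" using cong power by (metis One_nat_def one)
  then have "norm (\<chi> n) ^ totient q = 1" by (metis norm_one norm_power)
  then show ?thesis using q_pos using q_pos power_eq_imp_eq_base[of "norm (\<chi> n)" "totient q" 1] by simp
qed

lemma norm_le_1: "norm (\<chi> n) \<le> 1"
  using norm_eq_1[of n] nonzero_iff[of n] by (cases "\<chi> n = 0") auto

definition partial_L1 :: "nat \<Rightarrow> complex" where
  "partial_L1 N = (\<Sum>n=1..N. \<chi> n / of_nat n)"

definition twisted_mangoldt :: "nat \<Rightarrow> complex" where
  "twisted_mangoldt N = (\<Sum>n=1..N. \<chi> n * of_real (mangoldt n / real n))"

text \<open>
  The character carries the identity \<open>ln n = (\<Sum>d | d dvd n. \<Lambda>(d))\<close> over to the weights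
  \<open>\<chi>(n) / n\<close>. If the inner partial sums of the L-series are replaced by their limit, the right-hand
  side becomes \<open>L(1, \<chi>)\<close> times the twisted sum of \<open>\<Lambda>\<close>.
\<close>

lemma mangoldt_convolution:
  "(\<Sum>n=1..N. \<chi> n * of_real (ln (real n) / real n))
     = (\<Sum>d=1..N. \<chi> d * of_real (mangoldt d / real d) * partial_L1 (N div d))"
proof -
  have "(\<Sum>n=1..N. \<chi> n * of_real (ln (real n) / real n)) =
     (\<Sum>n=1..N. \<Sum>d | d dvd n. \<chi> d * of_real (mangoldt d / real d) * (\<chi> (n div d) / of_nat (n div d)))"
  proof (intro sum.cong refl, goal_cases)
    case (1 n)
    then have n: "n > 0" by simp
    then have "ln (real n) = (\<Sum>d | d dvd n. mangoldt d)" by (simp add: mangoldt_sum)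
    then have "\<chi> n * of_real (ln (real n) / real n)
        = (\<Sum>d | d dvd n. \<chi> n * of_real (mangoldt d / real n))"
      by (simp add: sum_distrib_left sum_divide_distrib)
    also have "\<dots> = (\<Sum>d | d dvd n. \<chi> d * of_real (mangoldt d / real d) * (\<chi> (n div d) / of_nat (n div d)))"
    proof (intro sum.cong refl, goal_cases)
      case (1 d)
      then obtain k where k: "n = d * k" by auto
      then have "d > 0" "k > 0" using n by auto
      then show ?case by (simp add: k mult)
    qed
    finally show ?case .
  qed
  also have "\<dots> = (\<Sum>d=1..N. \<Sum>k=1..N div d. \<chi> d * of_real (mangoldt d / real d) * (\<chi> k / of_nat k))"
    by (rule sum_divisors_swap)
  finally show ?thesis by (simp add: partial_L1_def sum_distrib_left)
qed

text \<open>
  The counterpart of \<open>mangoldt_convolution\<close> for \<open>L(1, \<chi>) = 0\<close>, where the latter says nothing. It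
  rests on \<open>(\<Sum>d | d dvd n. moebius d * ln (N / d)) = \<Lambda>(n)\<close>, to which \<open>n = 1\<close> adds \<open>ln N\<close>; the
  left-hand side is small since the partial sums of the L-series tend to 0.
\<close>

lemma moebius_convolution:
  assumes "N > 0"
  shows "(\<Sum>d=1..N. \<chi> d * of_real (moebius d / real d) * (of_real (ln (real N / real d)) * partial_L1 (N div d)))
      = twisted_mangoldt N + of_real (ln (real N))"
proof -
  have "(\<Sum>d=1..N. \<chi> d * of_real (moebius d / real d) * (of_real (ln (real N / real d)) * partial_L1 (N div d)))
      = (\<Sum>d=1..N. \<Sum>k=1..N div d. \<chi> d * of_real (moebius d / real d) * (of_real (ln (real N / real d)) * (\<chi> k / of_nat k)))"
    by (simp add: partial_L1_def sum_distrib_left)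
  also have "\<dots> = (\<Sum>n=1..N. \<Sum>d | d dvd n. \<chi> d * of_real (moebius d / real d) *
      (of_real (ln (real N / real d)) * (\<chi> (n div d) / of_nat (n div d))))"
    by (rule sum_divisors_swap[symmetric])
  also have "\<dots> = (\<Sum>n=1..N. \<chi> n * of_real (mangoldt n / real n) + (if n = 1 then of_real (ln (real N)) else 0))"
  proof (intro sum.cong refl, goal_cases)
    case (1 n)
    then have n: "n > 0" by simp
    have "(\<Sum>d | d dvd n. \<chi> d * of_real (moebius d / real d) *
          (of_real (ln (real N / real d)) * (\<chi> (n div d) / of_nat (n div d))))
       = (\<Sum>d | d dvd n. \<chi> n / of_nat n * of_real (moebius d * ln (real N) - moebius d * ln (real d)))"
    proof (intro sum.cong refl, goal_cases)
      case (1 d)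
      then obtain k where k: "n = d * k" by auto
      then have "d > 0" "k > 0" using n by auto
      then show ?case using assms by (simp add: k mult ln_div right_diff_distrib left_diff_distrib diff_divide_distrib mult_ac)
    qed
    also have "\<dots> = \<chi> n / of_nat n * of_real ((\<Sum>d | d dvd n. moebius d) * ln (real N)
         - (\<Sum>d | d dvd n. moebius d * ln (real d)))"
      by (simp only: sum_distrib_left[symmetric] of_real_sum[symmetric] sum_subtractf sum_distrib_right)
    also have "\<dots> = \<chi> n * of_real (mangoldt n / real n) + (if n = 1 then of_real (ln (real N)) else 0)"
      by (simp add: sum_moebius_ln[OF n] sum_moebius_divisors[OF n])
    finally show ?case .
  qed
  also have "\<dots> = twisted_mangoldt N + of_real (ln (real N))"
    using assms by (simp add: sum.distrib twisted_mangoldt_def)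
  finally show ?thesis .
qed

end

locale nonprincipal_character = dirichlet_character +
  assumes nonprincipal: "\<exists>a. coprime a q \<and> \<chi> a \<noteq> 1"
begin

text \<open>
  Multiplication by a unit \<open>a\<close> permutes the residue classes, so the sum is multiplied by
  \<open>\<chi> a \<noteq> 1\<close> without changing.
\<close>

lemma sum_period: "(\<Sum>n<q. \<chi> n) = 0"
proof -
  obtain a where a: "coprime a q" "\<chi> a \<noteq> 1" using nonprincipal by blast
  have inj: "inj_on (\<lambda>n. a * n mod q) {..<q}"
  proof (rule inj_onI)
    fix x y assume xy: "x \<in> {..<q}" "y \<in> {..<q}" "a * x mod q = a * y mod q"
    then have "[a * x = a * y] (mod q)" by (simp add: cong_def)
    then have "[x = y] (mod q)" using a(1) cong_mult_lcancel_nat by blast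
    then show "x = y" using xy by (simp add: cong_def)
  qed
  have "(\<lambda>n. a * n mod q) ` {..<q} = {..<q}"
    by (rule endo_inj_surj[OF _ _ inj]) (use q_pos in auto)
  then have "(\<Sum>n<q. \<chi> n) = (\<Sum>n<q. \<chi> (a * n mod q))"
    using sum.reindex[OF inj, of \<chi>] by simp
  also have "\<dots> = \<chi> a * (\<Sum>n<q. \<chi> n)" by (simp add: mult sum_distrib_left)
  finally show ?thesis using a(2) by (metis mult_cancel_right1)
qed

lemma norm_sum_le: "norm (\<Sum>n<N. \<chi> n) \<le> real q"
proof (induction N rule: less_induct)
  case (less N)
  show ?case
  proof (cases "N < q")
    case True
    have "norm (\<Sum>n<N. \<chi> n) \<le> (\<Sum>n<N. 1)" by (rule sum_norm_le) (rule norm_le_1)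
    then show ?thesis using True by simp
  next
    case False
    have "(\<Sum>n<N. \<chi> n) = (\<Sum>n<q. \<chi> n) + (\<Sum>n=q..<N. \<chi> n)"
      using False by (simp add: sum.atLeastLessThan_concat lessThan_atLeast0)
    also have "(\<Sum>n=q..<N. \<chi> n) = (\<Sum>n<N-q. \<chi> (n + q))"
      using False sum.shift_bounds_nat_ivl[of \<chi> 0 q "N - q"] by (simp add: lessThan_atLeast0)
    finally have "(\<Sum>n<N. \<chi> n) = (\<Sum>n<N-q. \<chi> n)" by (simp add: sum_period periodic)
    then show ?thesis using less[of "N - q"] False q_pos by simp
  qed
qed

lemma partial_L1_diff:
  assumes "K \<le> N"
  shows "norm (partial_L1 N - partial_L1 K) \<le> 2 * real q / real (Suc K)"
proof -
  have "partial_L1 N - partial_L1 K = (\<Sum>n=Suc K..<Suc N. \<chi> n * of_real (1 / real n))"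
  proof -
    have "{1..N} = {1..K} \<union> {Suc K..<Suc N}" using assms by auto
    then have "partial_L1 N = partial_L1 K + (\<Sum>n=Suc K..<Suc N. \<chi> n / of_nat n)"
      unfolding partial_L1_def by (simp only:, subst sum.union_disjoint) auto
    then show ?thesis by simp
  qed
  also have "norm \<dots> \<le> 2 * real q * (1 / real (Suc K))"
    by (rule abel_tail_bound) (use assms norm_sum_le in \<open>auto simp: field_simps\<close>)
  finally show ?thesis by simp
qed

definition L1 :: complex where "L1 = lim partial_L1"

lemma partial_L1_tendsto: "partial_L1 \<longlonglongrightarrow> L1"
proof -
  have "Cauchy partial_L1"
  proof (rule metric_CauchyI)
    fix e :: real assume e: "e > 0"
    obtain M where M: "2 * real q / e < real M" using reals_Archimedean2 by blast
    have *: "dist (partial_L1 m) (partial_L1 n) < e" if "m \<ge> n" "n \<ge> M" for m n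
    proof -
      have "2 * real q / e < real (Suc n)" using M that by simp
      then have "2 * real q / real (Suc n) < e" using e by (simp add: field_simps)
      then show ?thesis using partial_L1_diff[OF that(1)] by (simp add: dist_norm)
    qed
    show "\<exists>M. \<forall>m\<ge>M. \<forall>n\<ge>M. dist (partial_L1 m) (partial_L1 n) < e"
      using * by (metis dist_commute nle_le)
  qed
  then have "convergent partial_L1" by (rule Cauchy_convergent)
  then show ?thesis unfolding L1_def by (simp add: convergent_LIMSEQ_iff)
qed

lemma L1_approx: "norm (partial_L1 K - L1) \<le> 2 * real q / real (Suc K)"
proof -
  have "(\<lambda>N. norm (partial_L1 N - partial_L1 K)) \<longlonglongrightarrow> norm (L1 - partial_L1 K)"
    by (intro tendsto_intros partial_L1_tendsto)
  then have "norm (L1 - partial_L1 K) \<le> 2 * real q / real (Suc K)"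
    by (rule LIMSEQ_le_const2) (use partial_L1_diff in blast)
  then show ?thesis by (simp add: norm_minus_commute)
qed

text \<open>
  The form in which the rate of convergence is used: the factor \<open>d\<close> in the error cancels the weight
  \<open>1 / d\<close> of the \<open>d\<close>-th term of the convolutions.
\<close>

lemma L1_approx_div:
  assumes "N > 0" "d > 0"
  shows "norm (partial_L1 (N div d) - L1) \<le> 2 * real q * real d / real N"
proof -
  have "real N / real d \<le> real (Suc (N div d))" using of_nat_div_ge[of N d] by simp
  then have "2 * real q / real (Suc (N div d)) \<le> 2 * real q / (real N / real d)"
    using assms by (intro divide_left_mono) auto
  then show ?thesis using L1_approx[of "N div d"] by simp
qed

text \<open>
  Again summation by parts, but \<open>ln n / n\<close> decreases only from \<open>n = 3\<close> on.
\<close>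

lemma ln_sum_bounded: "\<exists>C. \<forall>N. norm (\<Sum>n=1..N. \<chi> n * of_real (ln (real n) / real n)) \<le> C"
proof -
  define g where "g n = \<chi> n * of_real (ln (real n) / real n)" for n
  have dec: "ln (real (Suc n)) / real (Suc n) \<le> ln (real n) / real n" if n: "n \<ge> 3" for n
  proof -
    have "ln (real (Suc n)) = ln (real n) + ln (1 + 1 / real n)"
      using n by (subst ln_mult_pos[symmetric]) (auto simp: distrib_left add.commute intro: add_pos_pos)
    also have "\<dots> \<le> ln (real n) + 1 / real n"
      using n by (intro add_left_mono ln_add_one_self_le_self) auto
    finally have "real n * ln (real (Suc n)) \<le> real n * ln (real n) + 1"
      using n by (simp add: field_simps)
    moreover have "ln (real n) \<ge> 1"
      using n exp_le by (subst ln_ge_iff) auto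
    ultimately show ?thesis using n by (simp add: field_simps)
  qed
  have tail: "norm (\<Sum>n=3..<N. g n) \<le> 2 * real q * (ln (real 3) / real 3)" if "N \<ge> 3" for N
    unfolding g_def by (rule abel_tail_bound) (use that dec norm_sum_le in auto)
  define C where "C = 2 * real q * (ln (real 3) / real 3)"
  have C0: "C \<ge> 0" by (simp add: C_def)
  have "norm (\<Sum>n=1..N. g n) \<le> norm (g 1) + norm (g 2) + C" for N
  proof -
    consider "N = 0" | "N = 1" | "N \<ge> 2" by linarith
    then show ?thesis
    proof cases
      case 3
      then have "{1..N} = {1} \<union> {2} \<union> {3..<Suc N}" by auto
      then have "(\<Sum>n=1..N. g n) = g 1 + g 2 + (\<Sum>n=3..<Suc N. g n)"
        by (simp add: sum.union_disjoint add.assoc del: One_nat_def)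
      moreover have "norm (\<Sum>n=3..<Suc N. g n) \<le> C" using tail[of "Suc N"] 3 by (simp add: C_def)
      ultimately show ?thesis by (metis norm_triangle_ineq add_mono norm_triangle_le order_refl)
    qed (use C0 in auto)
  qed
  then show ?thesis unfolding g_def by blast
qed

text \<open>
  In \<open>mangoldt_convolution\<close> the left-hand side is bounded, and the right-hand side is
  \<open>L(1, \<chi>) * M\<^sub>\<chi>(N)\<close> up to the sum of \<open>\<Lambda>(d) / d * O(d / N)\<close>, which is \<open>O(\<psi>(N) / N) = O(1)\<close> by
  Chebyshev's bound. Dividing by \<open>L(1, \<chi>)\<close> gives the claim.
\<close>

theorem twisted_mangoldt_bounded:
  assumes "L1 \<noteq> 0"
  shows "\<exists>C. \<forall>N. norm (twisted_mangoldt N) \<le> C"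
proof -
  obtain C where C: "\<And>N. norm (\<Sum>n=1..N. \<chi> n * of_real (ln (real n) / real n)) \<le> C"
    using ln_sum_bounded by blast
  have "norm (twisted_mangoldt N) \<le> (C + 12 * real q) / norm L1" if N: "N > 0" for N
  proof -
    define E where "E = (\<Sum>d=1..N. \<chi> d * of_real (mangoldt d / real d) * (partial_L1 (N div d) - L1))"
    have eq: "twisted_mangoldt N * L1 = (\<Sum>n=1..N. \<chi> n * of_real (ln (real n) / real n)) - E"
      unfolding mangoldt_convolution E_def twisted_mangoldt_def
      by (simp add: sum_distrib_right right_diff_distrib sum_subtractf)
    have "norm E \<le> (\<Sum>d=1..N. mangoldt d * (2 * real q / real N))"
      unfolding E_def
    proof (rule sum_norm_le)
      fix d assume "d \<in> {1..N}"
      then have d: "d > 0" by simp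
      have "norm (\<chi> d * of_real (mangoldt d / real d) * (partial_L1 (N div d) - L1))
          = norm (\<chi> d) * (mangoldt d / real d) * norm (partial_L1 (N div d) - L1)"
        by (simp add: norm_mult norm_divide mangoldt_nonneg)
      also have "\<dots> \<le> 1 * (mangoldt d / real d) * (2 * real q * real d / real N)"
        using d N by (intro mult_mono norm_le_1 L1_approx_div) (auto simp: mangoldt_nonneg)
      also have "\<dots> = mangoldt d * (2 * real q / real N)" using d by simp
      finally show "norm (\<chi> d * of_real (mangoldt d / real d) * (partial_L1 (N div d) - L1))
          \<le> mangoldt d * (2 * real q / real N)" .
    qed
    also have "\<dots> = chebyshev_psi N * (2 * real q / real N)"
      unfolding chebyshev_psi_def by (rule sum_distrib_right[symmetric])
    also have "\<dots> \<le> 6 * real N * (2 * real q / real N)"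
      by (intro mult_right_mono chebyshev_psi_upper) auto
    also have "\<dots> = 12 * real q" using N by simp
    finally have "norm (twisted_mangoldt N * L1) \<le> C + 12 * real q"
      unfolding eq using C by (intro norm_triangle_le_diff add_mono) auto
    then show ?thesis using assms by (simp add: norm_mult field_simps)
  qed
  then have "norm (twisted_mangoldt N) \<le> max (norm (twisted_mangoldt 0)) ((C + 12 * real q) / norm L1)" for N
    by (cases "N = 0") (auto simp: le_max_iff_disj)
  then show ?thesis by blast
qed

text \<open>
  Shapiro's argument. With limit 0, the partial sums in \<open>moebius_convolution\<close> are themselves
  \<open>O(d / N)\<close>, which leaves \<open>O(1 / N)\<close> times the sum of \<open>ln (N / d)\<close> over \<open>d \<le> N\<close>; by
  \<open>sum_ln_lower\<close> that sum is at most \<open>N\<close>.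
\<close>

theorem twisted_mangoldt_if_L1_zero:
  assumes "L1 = 0" "N > 0"
  shows "norm (twisted_mangoldt N + of_real (ln (real N))) \<le> 2 * real q"
proof -
  have "norm (twisted_mangoldt N + of_real (ln (real N))) \<le> (\<Sum>d=1..N. ln (real N / real d) * (2 * real q / real N))"
    unfolding moebius_convolution[OF assms(2), symmetric]
  proof (rule sum_norm_le)
    fix d assume "d \<in> {1..N}"
    then have d: "d > 0" "d \<le> N" by auto
    then have ln: "ln (real N / real d) \<ge> 0" by simp
    have "norm (\<chi> d * of_real (moebius d / real d) * (of_real (ln (real N / real d)) * partial_L1 (N div d)))
        = norm (\<chi> d) * (\<bar>moebius d\<bar> / real d) * (ln (real N / real d) * norm (partial_L1 (N div d) - L1))"
      using ln assms by (simp add: norm_mult norm_divide)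
    also have "\<dots> \<le> 1 * (1 / real d) * (ln (real N / real d) * (2 * real q * real d / real N))"
      using d ln assms by (intro mult_mono norm_le_1 L1_approx_div divide_right_mono abs_moebius_le) auto
    also have "\<dots> = ln (real N / real d) * (2 * real q / real N)" using d by simp
    finally show "norm (\<chi> d * of_real (moebius d / real d) * (of_real (ln (real N / real d)) * partial_L1 (N div d)))
        \<le> ln (real N / real d) * (2 * real q / real N)" .
  qed
  also have "\<dots> = (real N * ln (real N) - (\<Sum>d=1..N. ln (real d))) * (2 * real q / real N)"
  proof -
    have "(\<Sum>d=1..N. ln (real N / real d)) = real N * ln (real N) - (\<Sum>d=1..N. ln (real d))"
      using assms by (simp add: ln_div sum_subtractf)
    then show ?thesis by (simp only: sum_distrib_right[symmetric])
  qed
  also have "\<dots> \<le> real N * (2 * real q / real N)"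
    using sum_ln_lower[of N] by (intro mult_right_mono) auto
  also have "\<dots> = 2 * real q" using assms by simp
  finally show ?thesis .
qed

end

section \<open>Prime powers and the principal character\<close>

text \<open>
  The summand is at most the decrement of \<open>(2 + ln n) / n\<close> from \<open>n - 1\<close> to \<open>n\<close>, so the sum
  telescopes. The 2 in the numerator makes up for \<open>n * ln (n / (n - 1)) \<le> n / (n - 1) \<le> 2\<close>.
\<close>

lemma sum_ln_telescope_bound: "(\<Sum>n=2..N. ln (real n) / (real n * (real n - 1))) \<le> 2"
proof (cases "N \<ge> 1")
  case True
  have "(\<Sum>n=2..N. ln (real n) / (real n * (real n - 1))) \<le> 2 - (2 + ln (real N)) / real N"
    using True
  proof (induction N rule: dec_induct)
    case (step n)
    have n: "real n > 0" using step by simp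
    have "ln (real (Suc n)) = ln (real n) + ln (1 + 1 / real n)"
      using n by (subst ln_mult_pos[symmetric]) (auto simp: distrib_left add.commute intro: add_pos_pos)
    also have "\<dots> \<le> ln (real n) + 1 / real n"
      using n by (intro add_left_mono ln_add_one_self_le_self) auto
    finally have "real (Suc n) * ln (real (Suc n)) \<le> real (Suc n) * (ln (real n) + 1 / real n)"
      by (intro mult_left_mono) auto
    also have "\<dots> \<le> real (Suc n) * ln (real n) + 2"
      using n step by (simp add: field_simps)
    finally have key: "real (Suc n) * ln (real (Suc n)) \<le> real (Suc n) * ln (real n) + 2" .
    have "ln (real (Suc n)) / (real (Suc n) * (real (Suc n) - 1))
        \<le> (2 + ln (real n)) / real n - (2 + ln (real (Suc n))) / real (Suc n)"
    proof -
      have "(2 + ln (real n)) / real n - (2 + ln (real (Suc n))) / real (Suc n)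
          - ln (real (Suc n)) / (real (Suc n) * (real (Suc n) - 1))
        = (real (Suc n) * ln (real n) + 2 - real (Suc n) * ln (real (Suc n))) / (real (Suc n) * real n)"
      proof -
        have "(2 + l) / y - (2 + L) / (y + 1) - L / ((y + 1) * y) = ((y + 1) * l + 2 - (y + 1) * L) / ((y + 1) * y)"
          if "y > 0" for y l L :: real
          using that by (simp add: divide_simps) (simp add: algebra_simps)
        from this[OF n, of "ln (real n)" "ln (real (Suc n))"] show ?thesis by (simp add: add.commute)
      qed
      also have "\<dots> \<ge> 0" using n key by (intro divide_nonneg_nonneg) auto
      finally show ?thesis by linarith
    qed
    then show ?case using step by (simp del: of_nat_Suc)
  qed simp
  moreover have "(2 + ln (real N)) / real N \<ge> 0" using True by simp
  ultimately show ?thesis by linarith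
qed simp

text \<open>
  Only the powers \<open>p ^ k\<close> with \<open>k \<ge> 2\<close> count, and for each \<open>p\<close> the geometric series sums up to
  \<open>ln p / (p * (p - 1))\<close>.
\<close>

theorem sum_mangoldt_nonprime_bounded:
  "(\<Sum>n | n \<in> {1..N} \<and> \<not> prime n. mangoldt n / real n) \<le> 2"
proof -
  define A where "A = {n. n \<in> {1..N} \<and> \<not> prime n \<and> primepow n}"
  have "(\<Sum>n | n \<in> {1..N} \<and> \<not> prime n. mangoldt n / real n) = (\<Sum>n\<in>A. mangoldt n / real n)"
    unfolding A_def by (intro sum.mono_neutral_right) (auto simp: mangoldt_def)
  also have "\<dots> \<le> (\<Sum>n\<in>(\<lambda>(p,k). p ^ k) ` ({p\<in>{2..N}. prime p} \<times> {2..N}). mangoldt n / real n)"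
  proof (rule sum_mono2)
    show "A \<subseteq> (\<lambda>(p,k). p ^ k) ` ({p\<in>{2..N}. prime p} \<times> {2..N})"
    proof
      fix n assume n: "n \<in> A"
      then obtain p k where pk: "prime p" "k > 0" "n = p ^ k"
        by (auto simp: A_def primepow_def prime_elem_nat_iff)
      have "k \<noteq> 1" using n pk by (auto simp: A_def)
      moreover have "p \<le> n" using pk by (metis dvd_imp_le dvd_power n A_def mem_Collect_eq
           atLeastAtMost_iff less_eq_Suc_le One_nat_def)
      moreover have "k < p ^ k" using pk prime_gt_1_nat by (intro power_gt_expt) auto
      moreover have "n \<le> N" using n by (simp add: A_def)
      ultimately show "n \<in> (\<lambda>(p,k). p ^ k) ` ({p\<in>{2..N}. prime p} \<times> {2..N})"
        using pk prime_ge_2_nat by (intro image_eqI[of _ _ "(p,k)"]) auto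
    qed
  qed (auto simp: mangoldt_nonneg)
  also have "\<dots> \<le> sum ((\<lambda>n. mangoldt n / real n) \<circ> (\<lambda>(p,k). p ^ k)) ({p\<in>{2..N}. prime p} \<times> {2..N})"
    by (rule sum_image_le) (auto simp: mangoldt_nonneg)
  also have "\<dots> = (\<Sum>(p,k)\<in>{p\<in>{2..N}. prime p} \<times> {2..N}. mangoldt (p ^ k) / real (p ^ k))"
    by (simp add: case_prod_unfold o_def)
  also have "\<dots> = (\<Sum>p | p \<in> {2..N} \<and> prime p. \<Sum>k=2..N. ln (real p) / real p ^ k)"
    by (subst sum.cartesian_product[symmetric]) (auto intro!: sum.cong)
  also have "\<dots> \<le> (\<Sum>p | p \<in> {2..N} \<and> prime p. ln (real p) / (real p * (real p - 1)))"
  proof (rule sum_mono)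
    fix p assume "p \<in> {p \<in> {2..N}. prime p}"
    then have p: "real p \<ge> 2" by auto
    have "(\<Sum>k=2..N. (1 / real p) ^ k) \<le> 1 / (real p * (real p - 1))"
    proof (cases "N \<ge> 1")
      case True
      have "(\<Sum>k=2..N. (1 / real p) ^ k) \<le> 1 / (real p * (real p - 1)) - (1 / real p) ^ N / (real p - 1)"
        using True
      proof (induction N rule: dec_induct)
        case (step n)
        have "x * (1 / real p) = x / (real p - 1) - x * (1 / real p) / (real p - 1)" for x
          using p by (simp add: divide_simps) (simp add: algebra_simps)
        from this[of "(1 / real p) ^ n"]
        have "(1 / real p) ^ Suc n \<le> (1 / real p) ^ n / (real p - 1) - (1 / real p) ^ Suc n / (real p - 1)"
          unfolding power_Suc2 by (rule eq_refl)
        then show ?case using step by simp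
      qed (use p in simp)
      moreover have "(1 / real p) ^ N / (real p - 1) \<ge> 0" using p by simp
      ultimately show ?thesis by linarith
    qed (use p in simp)
    then have "ln (real p) * (\<Sum>k=2..N. (1 / real p) ^ k) \<le> ln (real p) * (1 / (real p * (real p - 1)))"
      using p by (intro mult_left_mono) auto
    then show "(\<Sum>k=2..N. ln (real p) / real p ^ k) \<le> ln (real p) / (real p * (real p - 1))"
      by (simp add: sum_distrib_left power_divide)
  qed
  also have "\<dots> \<le> (\<Sum>p=2..N. ln (real p) / (real p * (real p - 1)))"
    by (rule sum_mono2) auto
  also have "\<dots> \<le> 2" by (rule sum_ln_telescope_bound)
  finally show ?thesis .
qed

definition characters :: "nat \<Rightarrow> (nat \<Rightarrow> complex) set" where
  "characters q = {\<chi>. dirichlet_character q \<chi>}"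

definition principal_character :: "nat \<Rightarrow> nat \<Rightarrow> complex" where
  "principal_character q n = (if coprime n q then 1 else 0)"

lemma principal_character_is_character:
  assumes "q > 0"
  shows "principal_character q \<in> characters q"
proof -
  have "coprime (n + q) q \<longleftrightarrow> coprime n q" for n
    by (simp only: coprime_iff_gcd_eq_1 gcd_add1)
  then show ?thesis using assms
    by (auto simp: characters_def principal_character_def dirichlet_character_def)
qed

lemma nonprincipal_characterI:
  assumes "\<chi> \<in> characters q" "\<chi> \<noteq> principal_character q"
  shows "nonprincipal_character q \<chi>"
proof -
  interpret dirichlet_character q \<chi> using assms by (simp add: characters_def)
  show ?thesis
  proof
    obtain n where n: "\<chi> n \<noteq> principal_character q n" using assms(2) by blast
    then have "coprime n q" using nonzero_iff[of n] by (auto simp: principal_character_def)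
    then show "\<exists>a. coprime a q \<and> \<chi> a \<noteq> 1"
      using n by (auto simp: principal_character_def)
  qed
qed

text \<open>
  A character is determined by its values on one period, and each of them is 0 or a root of unity of
  order dividing \<open>totient q\<close>.
\<close>

lemma finite_characters: "finite (characters q)"
proof (cases "q > 0")
  case q: True
  define R where "R = insert 0 {z :: complex. z ^ totient q = 1}"
  have finR: "finite R" using q unfolding R_def by (auto intro!: finite_roots_unity simp: Suc_le_eq)
  have "characters q \<subseteq> (\<lambda>f n. f (n mod q)) ` (PiE {..<q} (\<lambda>_. R))"
  proof
    fix \<chi> assume "\<chi> \<in> characters q"
    then interpret dirichlet_character q \<chi> by (simp add: characters_def)
    have "\<chi> n \<in> R" for n
    proof (cases "coprime n q")
      case True
      then have "[n ^ totient q = 1] (mod q)" by (rule euler_theorem)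
      then have "\<chi> n ^ totient q = 1" using cong power by (metis One_nat_def one)
      then show ?thesis by (simp add: R_def)
    qed (use nonzero_iff[of n] in \<open>auto simp: R_def\<close>)
    then show "\<chi> \<in> (\<lambda>f n. f (n mod q)) ` (PiE {..<q} (\<lambda>_. R))"
      using q by (intro image_eqI[of _ _ "restrict \<chi> {..<q}"]) auto
  qed
  moreover have "finite ((\<lambda>f n. f (n mod q)) ` (PiE {..<q} (\<lambda>_. R)))"
    using finR by (intro finite_imageI finite_PiE) auto
  ultimately show ?thesis by (rule finite_subset)
qed (auto simp: characters_def dirichlet_character_def)

lemma character_mult:
  assumes "\<chi> \<in> characters q" "\<psi> \<in> characters q"
  shows "(\<lambda>n. \<chi> n * \<psi> n) \<in> characters q"
  using assms unfolding characters_def dirichlet_character_def by (auto simp: mult_ac)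

lemma character_cnj:
  assumes "\<chi> \<in> characters q"
  shows "(\<lambda>n. cnj (\<chi> n)) \<in> characters q"
  using assms unfolding characters_def dirichlet_character_def by auto

lemma (in nonprincipal_character) L1_cnj:
  "nonprincipal_character q (\<lambda>n. cnj (\<chi> n))"
  "nonprincipal_character.L1 (\<lambda>n. cnj (\<chi> n)) = cnj L1"
proof -
  have "\<chi> \<in> characters q" using dirichlet_character_axioms by (simp add: characters_def)
  then have c: "(\<lambda>n. cnj (\<chi> n)) \<in> characters q" by (rule character_cnj)
  show np: "nonprincipal_character q (\<lambda>n. cnj (\<chi> n))"
  proof (rule nonprincipal_characterI[OF c])
    obtain a where a: "coprime a q" "\<chi> a \<noteq> 1" using nonprincipal by blast
    then have "cnj (\<chi> a) \<noteq> principal_character q a" by (simp add: principal_character_def)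
    then show "(\<lambda>n. cnj (\<chi> n)) \<noteq> principal_character q" by metis
  qed
  interpret C: nonprincipal_character q "\<lambda>n. cnj (\<chi> n)" by (rule np)
  have "C.partial_L1 = (\<lambda>N. cnj (partial_L1 N))"
    by (simp add: fun_eq_iff C.partial_L1_def partial_L1_def)
  then show "C.L1 = cnj L1"
    using C.partial_L1_tendsto tendsto_cnj[OF partial_L1_tendsto] LIMSEQ_unique by metis
qed

text \<open>
  Mertens' first theorem without the terms at integers that are not coprime to \<open>q\<close>. Among these are
  only finitely many primes, namely divisors of \<open>q\<close>, and the remaining ones are covered by
  \<open>sum_mangoldt_nonprime_bounded\<close>.
\<close>

lemma principal_twisted_mangoldt:
  assumes "q > 0"
  shows "\<exists>C. \<forall>N>0. norm (dirichlet_character.twisted_mangoldt (principal_character q) N - of_real (ln (real N))) \<le> C"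
proof -
  interpret dirichlet_character q "principal_character q"
    using principal_character_is_character[OF assms] by (simp add: characters_def)
  define P where "P = (\<Sum>p\<in>prime_factors q. ln (real p))"
  \<comment> \<open>The 9 collects 7 from Mertens' first theorem and 2 from the proper prime powers.\<close>
  have "norm (twisted_mangoldt N - of_real (ln (real N))) \<le> 9 + P" for N
  proof -
    define D where "D = (\<Sum>n | n \<in> {1..N} \<and> \<not> coprime n q. mangoldt n / real n :: real)"
    have D0: "D \<ge> 0" unfolding D_def by (intro sum_nonneg) (simp add: mangoldt_nonneg)
    have "twisted_mangoldt N = of_real (\<Sum>n | n \<in> {1..N} \<and> coprime n q. mangoldt n / real n)"
      unfolding twisted_mangoldt_def principal_character_def of_real_sum
      by (intro sum.mono_neutral_cong_right) auto
    also have "(\<Sum>n | n \<in> {1..N} \<and> coprime n q. mangoldt n / real n) = (\<Sum>n=1..N. mangoldt n / real n) - D"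
    proof -
      have "(\<Sum>n=1..N. mangoldt n / real n) = (\<Sum>n | n \<in> {1..N} \<and> coprime n q. mangoldt n / real n) + D"
        unfolding D_def
        by (subst sum.union_disjoint[symmetric]) (auto intro!: arg_cong[where f = "sum (\<lambda>n. mangoldt n / real n)"])
      then show ?thesis by simp
    qed
    finally have "twisted_mangoldt N - of_real (ln (real N))
        = of_real ((\<Sum>n=1..N. mangoldt n / real n) - ln (real N) - D)" by simp
    then have "norm (twisted_mangoldt N - of_real (ln (real N)))
        = \<bar>(\<Sum>n=1..N. mangoldt n / real n) - ln (real N) - D\<bar>" by (simp only: norm_of_real)
    also have "\<dots> \<le> 7 + D" using mertens_first[of N] D0 by linarith
    also have "D \<le> P + 2"
    proof -
      define A where "A = {n. n \<in> {1..N} \<and> \<not> coprime n q \<and> prime n}"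
      define B where "B = {n. n \<in> {1..N} \<and> \<not> coprime n q \<and> \<not> prime n}"
      have "{n. n \<in> {1..N} \<and> \<not> coprime n q} = A \<union> B" by (auto simp: A_def B_def)
      then have "D = (\<Sum>n\<in>A. mangoldt n / real n) + (\<Sum>n\<in>B. mangoldt n / real n)"
        unfolding D_def by (simp only:, subst sum.union_disjoint) (auto simp: A_def B_def)
      moreover have "(\<Sum>n\<in>A. mangoldt n / real n) \<le> P"
      proof -
        have "A \<subseteq> prime_factors q"
          using assms prime_imp_coprime by (auto simp: A_def prime_factors_dvd)
        then have "(\<Sum>n\<in>A. mangoldt n / real n) \<le> (\<Sum>n\<in>prime_factors q. mangoldt n / real n)"
          by (intro sum_mono2) (auto simp: mangoldt_nonneg)
        also have "\<dots> \<le> P" unfolding P_def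
        proof (rule sum_mono)
          fix p assume "p \<in> prime_factors q"
          then have p: "prime p" by auto
          then have "p \<ge> 1" using prime_gt_0_nat by (simp add: Suc_le_eq)
          then have "ln (real p) * 1 \<le> ln (real p) * real p" by (intro mult_left_mono) auto
          then show "mangoldt p / real p \<le> ln (real p)"
            using p \<open>p \<ge> 1\<close> by (simp add: field_simps)
        qed
        finally show ?thesis .
      qed
      moreover have "(\<Sum>n\<in>B. mangoldt n / real n) \<le> 2"
      proof -
        have "(\<Sum>n\<in>B. mangoldt n / real n) \<le> (\<Sum>n | n \<in> {1..N} \<and> \<not> prime n. mangoldt n / real n)"
          unfolding B_def by (intro sum_mono2) (auto simp: mangoldt_nonneg)
        then show ?thesis using sum_mangoldt_nonprime_bounded[of N] by linarith
      qed
      ultimately show ?thesis by linarith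
    qed
    finally show ?thesis by simp
  qed
  then show ?thesis by blast
qed

section \<open>Primes in progressions when characters separate residue classes\<close>

lemma unbounded_ln_coeff:
  assumes "\<And>N. N > 0 \<Longrightarrow> c * ln (real N) \<le> (C :: real)"
  shows "c \<le> 0"
proof (rule ccontr)
  assume "\<not> c \<le> 0"
  then have c: "c > 0" by simp
  obtain N where N: "exp (C / c) < real N" using reals_Archimedean2 by blast
  then have pos: "N > 0" by (metis exp_gt_zero less_trans of_nat_0_less_iff)
  then have "C / c < ln (real N)" using N by (metis ln_exp ln_less_cancel_iff exp_gt_zero of_nat_0_less_iff)
  then have "C < c * ln (real N)" using c by (simp add: field_simps)
  then show False using assms[OF pos] by simp
qed

text \<open>
  Orthogonality rests on the separation of residue classes by characters. In general this is the
  duality of finite abelian groups; for powers of two it is \<open>separated_modulus_two_power\<close>.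
\<close>

locale separated_modulus =
  fixes q :: nat
  assumes q_gt_1: "q > 1"
    and separation: "coprime n q \<Longrightarrow> \<not> [n = 1] (mod q) \<Longrightarrow> \<exists>\<psi>\<in>characters q. \<psi> n \<noteq> 1"
begin

lemma q_pos: "q > 0" using q_gt_1 by simp

lemma character_one: "\<chi> \<in> characters q \<Longrightarrow> \<chi> 1 = 1"
  using dirichlet_character.one[of q \<chi>] by (simp add: characters_def)

text \<open>
  If \<open>n\<close> is a unit other than 1, multiplication by a character \<open>\<psi>\<close> with \<open>\<psi> n \<noteq> 1\<close> permutes the
  characters, so the sum is multiplied by \<open>\<psi> n\<close> without changing.
\<close>

lemma sum_characters:
  "(\<Sum>\<chi>\<in>characters q. \<chi> n) = (if [n = 1] (mod q) then of_nat (card (characters q)) else 0)"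
proof -
  consider "[n = 1] (mod q)" | "\<not> [n = 1] (mod q)" "\<not> coprime n q" | "\<not> [n = 1] (mod q)" "coprime n q"
    by blast
  then show ?thesis
  proof cases
    case 1
    have "\<chi> n = 1" if "\<chi> \<in> characters q" for \<chi>
      using dirichlet_character.cong[of q \<chi>, OF _ 1] that character_one by (simp add: characters_def)
    then have "(\<Sum>\<chi>\<in>characters q. \<chi> n) = (\<Sum>\<chi>\<in>characters q. 1)" by (rule sum.cong[OF refl])
    then show ?thesis using 1 by simp
  next
    case 2
    have "\<chi> n = 0" if "\<chi> \<in> characters q" for \<chi>
      using dirichlet_character.nonzero_iff[of q \<chi> n] that 2 by (simp add: characters_def)
    then show ?thesis using 2 by (simp add: sum.neutral)
  next
    case 3
    obtain \<psi> where \<psi>: "\<psi> \<in> characters q" "\<psi> n \<noteq> 1" using separation 3 by blast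
    let ?F = "\<lambda>\<chi> k. \<chi> k * \<psi> k"
    have inj: "inj_on ?F (characters q)"
    proof (rule inj_onI)
      fix \<chi> \<chi>' assume *: "\<chi> \<in> characters q" "\<chi>' \<in> characters q" "?F \<chi> = ?F \<chi>'"
      show "\<chi> = \<chi>'"
      proof
        fix k
        show "\<chi> k = \<chi>' k"
        proof (cases "coprime k q")
          case True
          then have "\<psi> k \<noteq> 0" using \<psi> dirichlet_character.nonzero_iff[of q \<psi> k] by (simp add: characters_def)
          moreover have "\<chi> k * \<psi> k = \<chi>' k * \<psi> k" using *(3) by metis
          ultimately show ?thesis by simp
        next
          case False
          then show ?thesis
            using *(1,2) dirichlet_character.nonzero_iff[of q \<chi> k] dirichlet_character.nonzero_iff[of q \<chi>' k]
            by (simp add: characters_def)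
        qed
      qed
    qed
    have "?F ` characters q = characters q"
      by (rule endo_inj_surj[OF finite_characters _ inj]) (use \<psi> character_mult in auto)
    then have "(\<Sum>\<chi>\<in>characters q. \<chi> n) = (\<Sum>\<chi>\<in>characters q. \<chi> n * \<psi> n)"
      using sum.reindex[OF inj, of "\<lambda>\<chi>. \<chi> n"] by (simp add: o_def)
    then have "(\<Sum>\<chi>\<in>characters q. \<chi> n) = (\<Sum>\<chi>\<in>characters q. \<chi> n) * \<psi> n"
      by (rule trans) (rule sum_distrib_right[symmetric])
    then show ?thesis using \<psi>(2) 3 by (simp add: mult_cancel_left1)
  qed
qed

text \<open>
  The sum of \<open>\<chi> n\<close> over all \<open>\<chi>\<close> and all \<open>n < q\<close> is evaluated in both orders: only \<open>n = 1\<close> contributes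
  in one of them, only the principal character in the other.
\<close>

lemma card_characters: "card (characters q) = totient q"
proof -
  have X0: "principal_character q \<in> characters q" using principal_character_is_character q_pos by blast
  have "of_nat (card (characters q)) = (\<Sum>n<q. if n = 1 then of_nat (card (characters q)) else (0::complex))"
    using q_gt_1 by (subst sum.delta) auto
  also have "\<dots> = (\<Sum>n<q. \<Sum>\<chi>\<in>characters q. \<chi> n)"
    using q_gt_1 by (intro sum.cong) (auto simp: sum_characters cong_def)
  also have "\<dots> = (\<Sum>\<chi>\<in>characters q. \<Sum>n<q. \<chi> n)" by (rule sum.swap)
  also have "\<dots> = (\<Sum>\<chi>\<in>characters q. if \<chi> = principal_character q then of_nat (totient q) else 0)"
  proof (intro sum.cong refl, goal_cases)
    case (1 \<chi>)
    show ?case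
    proof (cases "\<chi> = principal_character q")
      case True
      have "(\<Sum>n<q. principal_character q n) = (\<Sum>n\<in>totatives q. 1)"
      proof (rule sum.mono_neutral_cong_right)
        show "totatives q \<subseteq> {..<q}"
        proof
          fix n assume n: "n \<in> totatives q"
          then have "n \<noteq> q" using q_gt_1 by (auto simp: totatives_def)
          then show "n \<in> {..<q}" using n by (auto simp: totatives_def)
        qed
        show "\<forall>n\<in>{..<q} - totatives q. principal_character q n = 0"
          using q_gt_1 by (auto simp: totatives_def principal_character_def intro!: Nat.gr0I)
      qed (auto simp: totatives_def principal_character_def)
      then show ?thesis using True by (simp add: totient_def)
    next
      case False
      then show ?thesis using nonprincipal_character.sum_period[OF nonprincipal_characterI[OF 1]] by simp
    qed
  qed
  also have "\<dots> = of_nat (totient q)" using X0 finite_characters by (subst sum.delta) auto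
  finally show ?thesis by (simp only: of_nat_eq_iff)
qed

text \<open>
  Here \<open>b\<close> is an inverse of \<open>a\<close>, so orthogonality at \<open>b * n\<close> selects the class of \<open>a\<close>.
\<close>

lemma sum_twisted_mangoldt:
  assumes "[a * b = 1] (mod q)"
  shows "(\<Sum>\<chi>\<in>characters q. \<chi> b * dirichlet_character.twisted_mangoldt \<chi> N)
    = of_nat (totient q) * of_real (\<Sum>n | n \<in> {1..N} \<and> [n = a] (mod q). mangoldt n / real n)"
proof -
  have iff: "[b * n = 1] (mod q) \<longleftrightarrow> [n = a] (mod q)" for n
  proof
    assume "[b * n = 1] (mod q)"
    then have 1: "[a * b * n = a] (mod q)" using cong_scalar_left[of "b * n" 1 q a] by (simp add: mult.assoc)
    have 2: "[a * b * n = n] (mod q)" using cong_scalar_right[OF assms, of n] by simp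
    show "[n = a] (mod q)" by (rule cong_trans[OF cong_sym[OF 2] 1])
  next
    assume "[n = a] (mod q)"
    then have "[b * n = b * a] (mod q)" by (rule cong_scalar_left)
    then show "[b * n = 1] (mod q)" by (rule cong_trans) (use assms in \<open>simp add: mult.commute\<close>)
  qed
  have "(\<Sum>\<chi>\<in>characters q. \<chi> b * dirichlet_character.twisted_mangoldt \<chi> N)
      = (\<Sum>\<chi>\<in>characters q. \<Sum>n=1..N. \<chi> (b * n) * of_real (mangoldt n / real n))"
  proof (intro sum.cong refl, goal_cases)
    case (1 \<chi>)
    then interpret dirichlet_character q \<chi> by (simp add: characters_def)
    show ?case by (simp only: twisted_mangoldt_def mult sum_distrib_left mult.assoc)
  qed
  also have "\<dots> = (\<Sum>n=1..N. (\<Sum>\<chi>\<in>characters q. \<chi> (b * n)) * of_real (mangoldt n / real n))"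
    by (subst sum.swap) (simp only: sum_distrib_right)
  also have "\<dots> = (\<Sum>n | n \<in> {1..N} \<and> [n = a] (mod q). of_nat (totient q) * of_real (mangoldt n / real n))"
  proof (rule sum.mono_neutral_cong_right)
    show "\<forall>n\<in>{1..N} - {n \<in> {1..N}. [n = a] (mod q)}.
        (\<Sum>\<chi>\<in>characters q. \<chi> (b * n)) * complex_of_real (mangoldt n / real n) = 0"
      unfolding sum_characters iff by simp
  next
    fix n assume "n \<in> {n \<in> {1..N}. [n = a] (mod q)}"
    then have "[n = a] (mod q)" by simp
    then show "(\<Sum>\<chi>\<in>characters q. \<chi> (b * n)) * of_real (mangoldt n / real n)
        = of_nat (totient q) * complex_of_real (mangoldt n / real n)"
      unfolding sum_characters iff card_characters by simp
  qed auto
  finally show ?thesis by (simp only: sum_distrib_left of_real_sum)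
qed

definition L1_zeros :: "(nat \<Rightarrow> complex) set" where
  "L1_zeros = {\<chi>\<in>characters q. \<chi> \<noteq> principal_character q \<and> nonprincipal_character.L1 \<chi> = 0}"

text \<open>
  The coefficient of \<open>ln N\<close> in the growth of \<open>M\<^sub>\<chi>(N)\<close>; the value \<open>- 1\<close> is the one that
  \<open>twisted_mangoldt_if_L1_zero\<close> gives.
\<close>

definition growth_coeff :: "(nat \<Rightarrow> complex) \<Rightarrow> real" where
  "growth_coeff \<chi> = (if \<chi> = principal_character q then 1 else if \<chi> \<in> L1_zeros then -1 else 0)"

lemma twisted_mangoldt_growth:
  assumes "\<chi> \<in> characters q"
  shows "\<exists>C. \<forall>N>0. norm (dirichlet_character.twisted_mangoldt \<chi> N - of_real (growth_coeff \<chi> * ln (real N))) \<le> C"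
proof (cases "\<chi> = principal_character q")
  case True
  then show ?thesis using principal_twisted_mangoldt[OF q_pos] by (simp add: growth_coeff_def)
next
  case False
  interpret nonprincipal_character q \<chi> by (rule nonprincipal_characterI[OF assms False])
  show ?thesis
  proof (cases "L1 = 0")
    case True
    then have "growth_coeff \<chi> = -1" using assms False by (simp add: growth_coeff_def L1_zeros_def)
    then show ?thesis using twisted_mangoldt_if_L1_zero[OF True] by auto
  next
    case nz: False
    then have "growth_coeff \<chi> = 0" using assms False by (simp add: growth_coeff_def L1_zeros_def)
    then show ?thesis using twisted_mangoldt_bounded[OF nz] by auto
  qed
qed

theorem sum_mangoldt_class:
  assumes "[a * b = 1] (mod q)"
  shows "\<exists>C. \<forall>N>0. norm (of_nat (totient q) * of_real (\<Sum>n | n \<in> {1..N} \<and> [n = a] (mod q). mangoldt n / real n)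
      - (\<Sum>\<chi>\<in>characters q. \<chi> b * of_real (growth_coeff \<chi>)) * of_real (ln (real N))) \<le> C"
proof -
  obtain C where C: "\<And>\<chi> N. \<chi> \<in> characters q \<Longrightarrow> N > 0 \<Longrightarrow>
      norm (dirichlet_character.twisted_mangoldt \<chi> N - of_real (growth_coeff \<chi> * ln (real N))) \<le> C \<chi>"
    using twisted_mangoldt_growth by metis
  have "norm (of_nat (totient q) * of_real (\<Sum>n | n \<in> {1..N} \<and> [n = a] (mod q). mangoldt n / real n)
      - (\<Sum>\<chi>\<in>characters q. \<chi> b * of_real (growth_coeff \<chi>)) * of_real (ln (real N))) \<le> (\<Sum>\<chi>\<in>characters q. C \<chi>)"
    if "N > 0" for N
  proof -
    have "of_nat (totient q) * of_real (\<Sum>n | n \<in> {1..N} \<and> [n = a] (mod q). mangoldt n / real n)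
        - (\<Sum>\<chi>\<in>characters q. \<chi> b * of_real (growth_coeff \<chi>)) * of_real (ln (real N))
      = (\<Sum>\<chi>\<in>characters q. \<chi> b * (dirichlet_character.twisted_mangoldt \<chi> N - of_real (growth_coeff \<chi> * ln (real N))))"
      unfolding sum_twisted_mangoldt[OF assms, symmetric]
      by (simp add: right_diff_distrib sum_subtractf sum_distrib_right mult.assoc)
    also have "norm \<dots> \<le> (\<Sum>\<chi>\<in>characters q. C \<chi>)"
    proof (rule sum_norm_le)
      fix \<chi> assume \<chi>: "\<chi> \<in> characters q"
      then have "norm (\<chi> b) \<le> 1" using dirichlet_character.norm_le_1[of q \<chi>] by (simp add: characters_def)
      then have "norm (\<chi> b) * norm (dirichlet_character.twisted_mangoldt \<chi> N - of_real (growth_coeff \<chi> * ln (real N)))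
        \<le> 1 * C \<chi>" using C[OF \<chi> that] by (intro mult_mono) auto
      then show "norm (\<chi> b * (dirichlet_character.twisted_mangoldt \<chi> N - of_real (growth_coeff \<chi> * ln (real N)))) \<le> C \<chi>"
        by (simp only: norm_mult mult_1)
    qed
    finally show ?thesis .
  qed
  then show ?thesis by blast
qed

text \<open>
  In the class of 1 all coefficients are 1, so the sum of \<open>\<Lambda>(n) / n\<close> over that class has growth
  coefficient proportional to \<open>1 - card L1_zeros\<close>. A sum of nonnegative terms cannot tend to
  \<open>- \<infinity>\<close>.
\<close>

lemma card_L1_zeros: "card L1_zeros \<le> 1"
proof -
  obtain C where C: "\<And>N. N > 0 \<Longrightarrow> norm (of_nat (totient q) * of_real (\<Sum>n | n \<in> {1..N} \<and> [n = 1] (mod q). mangoldt n / real n)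
      - (\<Sum>\<chi>\<in>characters q. \<chi> 1 * of_real (growth_coeff \<chi>)) * of_real (ln (real N))) \<le> C"
    using sum_mangoldt_class[of 1 1] by auto
  have X0: "principal_character q \<in> characters q" using principal_character_is_character q_pos by blast
  have fin: "finite L1_zeros" "L1_zeros \<subseteq> characters q" using finite_characters by (auto simp: L1_zeros_def)
  have "(\<Sum>\<chi>\<in>characters q. growth_coeff \<chi>) = (\<Sum>\<chi>\<in>characters q. (if \<chi> = principal_character q then 1 else 0) - (if \<chi> \<in> L1_zeros then 1 else 0))"
    by (intro sum.cong) (auto simp: growth_coeff_def L1_zeros_def)
  also have "\<dots> = 1 - real (card L1_zeros)"
    using X0 fin finite_characters by (simp add: sum_subtractf sum.delta sum.If_cases Int_absorb1)
  finally have s: "(\<Sum>\<chi>\<in>characters q. growth_coeff \<chi>) = 1 - real (card L1_zeros)" .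
  have "(real (card L1_zeros) - 1) * ln (real N) \<le> C" if "N > 0" for N
  proof -
    define U where "U = (\<Sum>n | n \<in> {1..N} \<and> [n = 1] (mod q). mangoldt n / real n :: real)"
    have "U \<ge> 0" unfolding U_def by (intro sum_nonneg) (simp add: mangoldt_nonneg)
    have "(\<Sum>\<chi>\<in>characters q. \<chi> 1 * complex_of_real (growth_coeff \<chi>)) = of_real (1 - real (card L1_zeros))"
      unfolding s[symmetric] of_real_sum by (intro sum.cong refl) (use character_one in simp)
    then have "of_nat (totient q) * of_real U - (\<Sum>\<chi>\<in>characters q. \<chi> 1 * complex_of_real (growth_coeff \<chi>)) * of_real (ln (real N))
      = of_real (real (totient q) * U - (1 - real (card L1_zeros)) * ln (real N))" by simp
    then have "\<bar>real (totient q) * U - (1 - real (card L1_zeros)) * ln (real N)\<bar> \<le> C"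
      using C[OF that] unfolding U_def[symmetric] by (simp only: norm_of_real)
    moreover have "real (totient q) * U \<ge> 0" using \<open>U \<ge> 0\<close> by simp
    ultimately show ?thesis by (simp add: algebra_simps)
  qed
  then have "real (card L1_zeros) - 1 \<le> 0" by (rule unbounded_ln_coeff)
  then show ?thesis by simp
qed

text \<open>
  \<open>L(1, \<chi>)\<close> and \<open>L(1, cnj \<chi>)\<close> are conjugate, hence vanish together; as at most one character
  has a zero, \<open>\<chi>\<close> is its own conjugate.
\<close>

theorem L1_zero_imp_real:
  assumes "\<chi> \<in> characters q" "\<chi> \<noteq> principal_character q" "nonprincipal_character.L1 \<chi> = 0"
  shows "cnj (\<chi> n) = \<chi> n"
proof -
  interpret nonprincipal_character q \<chi> by (rule nonprincipal_characterI[OF assms(1,2)])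
  have 1: "\<chi> \<in> L1_zeros" using assms by (simp add: L1_zeros_def)
  have "(\<lambda>n. cnj (\<chi> n)) \<noteq> principal_character q"
  proof
    assume "(\<lambda>n. cnj (\<chi> n)) = principal_character q"
    then have "\<And>k. cnj (cnj (\<chi> k)) = cnj (principal_character q k)" by metis
    then have "\<chi> = principal_character q" by (auto simp: principal_character_def fun_eq_iff)
    then show False using assms by simp
  qed
  then have 2: "(\<lambda>n. cnj (\<chi> n)) \<in> L1_zeros"
    using assms character_cnj L1_cnj by (simp add: L1_zeros_def)
  have "finite L1_zeros" using finite_characters by (simp add: L1_zeros_def)
  then have "(\<lambda>n. cnj (\<chi> n)) = \<chi>" using card_L1_zeros 1 2 by (auto simp: card_le_Suc0_iff_eq)
  then show ?thesis by metis
qed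

theorem mertens_progression:
  assumes nonvanishing: "\<And>\<chi>. \<chi> \<in> characters q \<Longrightarrow> \<chi> \<noteq> principal_character q \<Longrightarrow> nonprincipal_character.L1 \<chi> \<noteq> 0"
    and a: "coprime a q"
  shows "\<exists>C. \<forall>N>0. \<bar>(\<Sum>n | n \<in> {1..N} \<and> [n = a] (mod q). mangoldt n / real n) - ln (real N) / real (totient q)\<bar> \<le> C"
proof -
  obtain b where b: "[a * b = 1] (mod q)" using a cong_solve_coprime_nat by auto
  then have "coprime b q" by (metis coprime_mult_left_iff cong_imp_coprime cong_sym coprime_1_left mult.commute)
  have "L1_zeros = {}" using nonvanishing by (auto simp: L1_zeros_def)
  then have "(\<Sum>\<chi>\<in>characters q. \<chi> b * complex_of_real (growth_coeff \<chi>)) = (\<Sum>\<chi>\<in>characters q. if \<chi> = principal_character q then 1 else 0)"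
    using \<open>coprime b q\<close> by (intro sum.cong) (auto simp: growth_coeff_def principal_character_def)
  also have "\<dots> = 1" using finite_characters principal_character_is_character[OF q_pos] by simp
  finally have s: "(\<Sum>\<chi>\<in>characters q. \<chi> b * complex_of_real (growth_coeff \<chi>)) = 1" .
  obtain C where C: "\<And>N. N > 0 \<Longrightarrow> norm (of_nat (totient q) * complex_of_real (\<Sum>n | n \<in> {1..N} \<and> [n = a] (mod q). mangoldt n / real n)
      - of_real (ln (real N))) \<le> C"
    using sum_mangoldt_class[OF b] unfolding s by auto
  have t: "real (totient q) > 0" using q_pos by simp
  have "\<bar>(\<Sum>n | n \<in> {1..N} \<and> [n = a] (mod q). mangoldt n / real n) - ln (real N) / real (totient q)\<bar> \<le> C / real (totient q)" if "N > 0" for N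
  proof -
    define U where "U = (\<Sum>n | n \<in> {1..N} \<and> [n = a] (mod q). mangoldt n / real n :: real)"
    have "of_nat (totient q) * complex_of_real U - of_real (ln (real N)) = of_real (real (totient q) * U - ln (real N))" by simp
    then have "\<bar>real (totient q) * U - ln (real N)\<bar> \<le> C" using C[OF that] unfolding U_def[symmetric] by (simp only: norm_of_real)
    moreover have "\<bar>real (totient q) * U - ln (real N)\<bar> = real (totient q) * \<bar>U - ln (real N) / real (totient q)\<bar>"
    proof -
      have "real (totient q) * U - ln (real N) = real (totient q) * (U - ln (real N) / real (totient q))"
        using t by (simp add: field_simps)
      then show ?thesis by (simp add: abs_mult)
    qed
    ultimately have "\<bar>U - ln (real N) / real (totient q)\<bar> * real (totient q) \<le> C"
      by (simp only: mult.commute)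
    then show ?thesis unfolding U_def[symmetric] by (simp only: pos_le_divide_eq[OF t])
  qed
  then show ?thesis by blast
qed

end

section \<open>Characters modulo a power of two\<close>

lemma five_power_two_power: "\<exists>u::int. odd u \<and> 5 ^ (2 ^ j) = 1 + 2 ^ (j + 2) * u"
proof (induction j)
  case 0
  then show ?case by (intro exI[of _ 1]) auto
next
  case (Suc j)
  then obtain u :: int where u: "odd u" "5 ^ (2 ^ j) = 1 + 2 ^ (j + 2) * u" by blast
  have "(5::int) ^ (2 ^ Suc j) = (5 ^ (2 ^ j)) ^ 2" by (simp add: power_mult[symmetric] mult.commute)
  also have "\<dots> = 1 + 2 ^ (Suc j + 2) * (u + 2 * 2 ^ j * u\<^sup>2)"
    unfolding u(2) by (simp add: power2_eq_square algebra_simps)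
  finally show ?case using u(1) by (intro exI[of _ "u + 2 * 2 ^ j * u\<^sup>2"]) auto
qed

text \<open>
  Powers of 5 are lifted from modulus \<open>2 ^ m\<close> to \<open>2 ^ Suc m\<close>: if the difference is an odd multiple of
  \<open>2 ^ m\<close>, raising the exponent by \<open>2 ^ (m - 2)\<close> changes \<open>5 ^ k\<close> by another odd multiple.
\<close>

theorem five_power_representation:
  fixes n :: int
  assumes "m \<ge> 2" "[n = 1] (mod 4)"
  shows "\<exists>k. [n = 5 ^ k] (mod 2 ^ m)"
  using assms(1)
proof (induction m rule: dec_induct)
  case base
  then show ?case using assms(2) by (intro exI[of _ 0]) simp
next
  case (step m)
  then obtain k where "[n = 5 ^ k] (mod 2 ^ m)" by blast
  then obtain t where t: "n - 5 ^ k = 2 ^ m * t" by (auto simp: cong_iff_dvd_diff)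
  show ?case
  proof (cases "even t")
    case True
    then have "2 ^ Suc m dvd n - 5 ^ k" unfolding t by auto
    then show ?thesis by (auto simp: cong_iff_dvd_diff)
  next
    case False
    obtain u :: int where u: "odd u" "5 ^ (2 ^ (m - 2)) = 1 + 2 ^ m * u"
      using five_power_two_power[of "m - 2"] le_add_diff_inverse2[OF step.hyps(1)] by (metis)
    have "n - 5 ^ (k + 2 ^ (m - 2)) = 2 ^ m * (t - 5 ^ k * u)"
      using t by (simp add: power_add u algebra_simps)
    moreover have "even (t - 5 ^ k * u)" using False u by simp
    ultimately have "2 ^ Suc m dvd n - 5 ^ (k + 2 ^ (m - 2))" by auto
    then show ?thesis by (metis cong_iff_dvd_diff)
  qed
qed

lemma five_power_eq_1_iff:
  assumes "m \<ge> 2"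
  shows "[5 ^ k = 1] (mod (2 ^ m :: int)) \<longleftrightarrow> 2 ^ (m - 2) dvd k"
proof (cases "m = 2")
  case True
  have "[5 ^ k = 1 ^ k] (mod (4::int))" by (intro cong_pow) (simp add: cong_def)
  then show ?thesis using True by simp
next
  case False
  then have m: "m \<ge> 3" using assms by simp
  have "[5 ^ k = 1] (mod (2 ^ m :: int)) \<longleftrightarrow> [5 ^ k = 1] (mod (2 ^ m :: nat))"
    using cong_int_iff[of "5 ^ k" 1 "2 ^ m"] by simp
  also have "\<dots> \<longleftrightarrow> ord (2 ^ m) (5::nat) dvd k" by (rule ord_divides)
  also have "ord (2 ^ m) (5::nat) = 2 ^ (m - 2)" using m by (intro ord_twopow_3_5) auto
  finally show ?thesis .
qed

text \<open>
  The exponent \<open>k\<close> is a logarithm of \<open>n\<close> to base 5, up to the sign of \<open>n\<close>. It is a relation because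
  \<open>k\<close> is only determined modulo \<open>2 ^ (m - 2)\<close>.
\<close>

definition log5_rel :: "nat \<Rightarrow> nat \<Rightarrow> nat \<Rightarrow> bool" where
  "log5_rel m n k \<longleftrightarrow> [int n = 5 ^ k] (mod 2 ^ m) \<or> [int n = - (5 ^ k)] (mod 2 ^ m)"

lemma odd_cong_4:
  assumes "odd n"
  shows "[int n = 1] (mod 4) \<or> [int n = 3] (mod 4)"
proof -
  have "n mod 4 = 1 \<or> n mod 4 = 3" using assms by presburger
  then have "[n = 1] (mod 4) \<or> [n = 3] (mod 4)" by (simp add: cong_def)
  then show ?thesis using cong_int_iff[of n 1 4] cong_int_iff[of n 3 4] by simp
qed

lemma log5_rel_exists:
  assumes "m \<ge> 2" "odd n"
  shows "\<exists>k. log5_rel m n k"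
proof -
  have "[int n = 1] (mod 4) \<or> [- int n = 1] (mod 4)"
    using odd_cong_4[OF assms(2)]
  proof
    assume "[int n = 3] (mod 4)"
    then have "[- int n = - 3] (mod 4)" by (simp only: cong_minus_minus_iff)
    then show ?thesis by (simp add: cong_def)
  qed simp
  then obtain k where "[int n = 5 ^ k] (mod 2 ^ m) \<or> [- int n = 5 ^ k] (mod 2 ^ m)"
    using five_power_representation[OF assms(1)] by blast
  then show ?thesis
    using cong_minus_minus_iff[of "- int n" "5 ^ k" "2 ^ m"] unfolding log5_rel_def by auto
qed

lemma five_power_cong_1_mod_4: "[5 ^ k = 1] (mod (4::int))"
  using cong_pow[of 5 1 "4::int" k] by (simp add: cong_def)

text \<open>
  The two signs cannot be mixed, since powers of 5 are 1 modulo 4; with equal signs the order of 5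
  decides.
\<close>

lemma log5_rel_unique:
  assumes m: "m \<ge> 2" and k: "log5_rel m n k" and l: "log5_rel m n l"
  shows "[k = l] (mod 2 ^ (m - 2))"
proof -
  have 4: "(4::int) dvd 2 ^ m" using le_imp_power_dvd[OF m, of "2::int"] by simp
  have no: "\<not> [5 ^ k = - (5 ^ l)] (mod (2 ^ m :: int))" for k l
  proof
    assume "[5 ^ k = - (5 ^ l)] (mod (2 ^ m :: int))"
    then have 1: "[5 ^ k = - (5 ^ l)] (mod (4::int))" using 4 by (rule cong_dvd_modulus)
    have 2: "[- (5 ^ l) = - 1] (mod (4::int))"
      using five_power_cong_1_mod_4[of l] by (simp only: cong_minus_minus_iff)
    have "[1 = - 1] (mod (4::int))"
      by (rule cong_trans[OF cong_sym[OF five_power_cong_1_mod_4] cong_trans[OF 1 2]])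
    then show False by (simp add: cong_def)
  qed
  have lift: "[k = l] (mod 2 ^ (m - 2))" if "k \<le> l" "[5 ^ k = 5 ^ l] (mod (2 ^ m :: int))" for k l
  proof -
    have "[5 ^ k * 1 = 5 ^ k * 5 ^ (l - k)] (mod (2 ^ m :: int))"
      using that by (simp add: power_add[symmetric])
    then have "[1 = 5 ^ (l - k)] (mod (2 ^ m :: int))"
      by (subst (asm) cong_mult_lcancel) auto
    then have "2 ^ (m - 2) dvd l - k" using five_power_eq_1_iff[OF m] cong_sym by blast
    then show ?thesis using that(1) by (metis cong_altdef_nat cong_sym)
  qed
  have "[5 ^ k = 5 ^ l] (mod (2 ^ m :: int))"
  proof -
    consider "[int n = 5 ^ k] (mod 2 ^ m)" "[int n = 5 ^ l] (mod 2 ^ m)"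
      | "[int n = 5 ^ k] (mod 2 ^ m)" "[int n = - (5 ^ l)] (mod 2 ^ m)"
      | "[int n = - (5 ^ k)] (mod 2 ^ m)" "[int n = 5 ^ l] (mod 2 ^ m)"
      | "[int n = - (5 ^ k)] (mod 2 ^ m)" "[int n = - (5 ^ l)] (mod 2 ^ m)"
      using k l unfolding log5_rel_def by blast
    then show ?thesis
    proof cases
      case 1
      then show ?thesis using cong_trans[OF cong_sym] by blast
    next
      case 2
      then show ?thesis using no[of k l] cong_trans[OF cong_sym] by blast
    next
      case 3
      then show ?thesis using no[of l k] cong_trans[OF cong_sym] by blast
    next
      case 4
      then have "[- (5 ^ k) = - (5 ^ l)] (mod (2 ^ m :: int))" using cong_trans[OF cong_sym] by blast
      then show ?thesis by (simp only: cong_minus_minus_iff)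
    qed
  qed
  then show ?thesis using lift[of k l] cong_sym[OF lift[of l k]] by (cases "k \<le> l") (auto simp: cong_sym_eq)
qed

lemma log5_rel_mult:
  assumes "log5_rel m a k" "log5_rel m b l"
  shows "log5_rel m (a * b) (k + l)"
proof -
  obtain s t :: int where s: "s = 1 \<or> s = -1" "[int a = s * 5 ^ k] (mod 2 ^ m)"
    and t: "t = 1 \<or> t = -1" "[int b = t * 5 ^ l] (mod 2 ^ m)"
    using assms unfolding log5_rel_def by (metis mult_1 mult_minus1)
  have "[int a * int b = (s * 5 ^ k) * (t * 5 ^ l)] (mod 2 ^ m)" by (rule cong_mult[OF s(2) t(2)])
  then have "[int (a * b) = (s * t) * 5 ^ (k + l)] (mod 2 ^ m)" by (simp add: power_add mult_ac)
  moreover have "s * t = 1 \<or> s * t = -1" using s(1) t(1) by auto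
  ultimately show ?thesis unfolding log5_rel_def by (elim disjE) (simp_all del: of_nat_mult)
qed

text \<open>
  The character that sends 5 to a primitive root of unity of order \<open>2 ^ (m - 2)\<close> and \<open>- 1\<close> to 1. The
  choice of the logarithm does not matter by \<open>log5_rel_unique\<close>.
\<close>

definition log5_character :: "nat \<Rightarrow> nat \<Rightarrow> complex" where
  "log5_character m n = (if odd n then cis (2 * pi / 2 ^ (m - 2)) ^ (SOME k. log5_rel m n k) else 0)"

lemma log5_character_eq:
  assumes m: "m \<ge> 2" and n: "odd n" and k: "log5_rel m n k"
  shows "log5_character m n = cis (2 * pi / 2 ^ (m - 2)) ^ k"
proof -
  let ?z = "cis (2 * pi / 2 ^ (m - 2))"
  have z1: "?z ^ (2 ^ (m - 2)) = 1" by (simp add: DeMoivre)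
  have zmod: "?z ^ (j mod 2 ^ (m - 2)) = ?z ^ j" for j
  proof -
    have "?z ^ j = ?z ^ (2 ^ (m - 2) * (j div 2 ^ (m - 2)) + j mod 2 ^ (m - 2))" by simp
    also have "\<dots> = ?z ^ (j mod 2 ^ (m - 2))" by (simp only: power_add power_mult z1 power_one mult_1)
    finally show ?thesis by simp
  qed
  define k' where "k' = (SOME k. log5_rel m n k)"
  have "log5_rel m n k'" using k unfolding k'_def by (rule someI)
  then have "[k' = k] (mod 2 ^ (m - 2))" using m k log5_rel_unique by blast
  then have "?z ^ k' = ?z ^ k" using zmod[of k'] zmod[of k] by (simp only: cong_def)
  then show ?thesis using n by (simp add: log5_character_def k'_def)
qed

lemma log5_character_is_character:
  assumes m: "m \<ge> 2"
  shows "log5_character m \<in> characters (2 ^ m)"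
proof -
  have "log5_character m (a * b) = log5_character m a * log5_character m b" for a b
  proof (cases "odd a \<and> odd b")
    case True
    then obtain k l where kl: "log5_rel m a k" "log5_rel m b l" using log5_rel_exists m by blast
    then show ?thesis
      using True log5_character_eq[OF m _ kl(1)] log5_character_eq[OF m _ kl(2)]
        log5_character_eq[OF m _ log5_rel_mult[OF kl]]
      by (simp add: power_add)
  qed (auto simp: log5_character_def)
  moreover have "log5_character m (n + 2 ^ m) = log5_character m n" for n
  proof (cases "odd n")
    case True
    then obtain k where k: "log5_rel m n k" using log5_rel_exists m by blast
    then have "log5_rel m (n + 2 ^ m) k" by (simp add: log5_rel_def cong_def)
    then show ?thesis
      using True m log5_character_eq[OF m _ k] log5_character_eq[OF m, of "n + 2 ^ m" k] by simp
  qed (use m in \<open>auto simp: log5_character_def\<close>)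
  moreover have "log5_character m n \<noteq> 0 \<longleftrightarrow> coprime n (2 ^ m)" for n
    using m by (simp add: log5_character_def)
  ultimately show ?thesis by (simp add: characters_def dirichlet_character_def)
qed

definition chi4_character :: "nat \<Rightarrow> complex" where
  "chi4_character n = of_int (chi4 (int n))"

lemma chi4_mod: "chi4 (n mod 4) = chi4 n"
  by (simp add: chi4_def cong_def)

lemma chi4_mult: "chi4 (a * b) = chi4 a * chi4 b"
proof -
  have "chi4 (x * y) = chi4 x * chi4 y" if "x \<in> {0, 1, 2, 3}" "y \<in> {0, 1, 2, 3}" for x y
    using that by (elim insertE emptyE; hypsubst) (simp_all add: chi4_def cong_def)
  moreover have "n mod 4 \<in> {0, 1, 2, 3}" for n :: int
  proof -
    have "n mod 4 \<in> {0..3}" by simp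
    also have "{0..3} = {0, 1, 2, 3 :: int}" by auto
    finally show ?thesis .
  qed
  ultimately have "chi4 ((a mod 4) * (b mod 4)) = chi4 (a mod 4) * chi4 (b mod 4)" by blast
  moreover have "chi4 ((a mod 4) * (b mod 4)) = chi4 (a * b)"
    using chi4_mod[of "(a mod 4) * (b mod 4)"] chi4_mod[of "a * b"] by (simp add: mod_mult_eq)
  ultimately show ?thesis by (simp add: chi4_mod)
qed

lemma chi4_character_is_character:
  assumes "m \<ge> 2"
  shows "chi4_character \<in> characters (2 ^ m)"
proof -
  have 4: "(4::int) dvd 2 ^ m" using le_imp_power_dvd[OF assms, of "2::int"] by simp
  then have "(int n + 2 ^ m) mod 4 = int n mod 4" for n by (metis add.right_neutral dvd_imp_mod_0 mod_add_right_eq)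
  then have "chi4_character (n + 2 ^ m) = chi4_character n" for n
    by (simp add: chi4_character_def chi4_def cong_def)
  moreover have "chi4_character n \<noteq> 0 \<longleftrightarrow> coprime n (2 ^ m)" for n
  proof -
    have "chi4 (int n) \<noteq> 0 \<longleftrightarrow> odd n"
    proof (cases "odd n")
      case True
      then show ?thesis using odd_cong_4[OF True] by (auto simp: chi4_def)
    next
      case False
      have "\<not> [int n = c] (mod 4)" if "odd c" for c
      proof
        assume "[int n = c] (mod 4)"
        then have "[int n = c] (mod 2)" by (rule cong_dvd_modulus) simp
        then have "even (int n) \<longleftrightarrow> even c" using cong_dvd_iff by blast
        then show False using False that by simp
      qed
      then show ?thesis using False by (simp add: chi4_def)
    qed
    then show ?thesis using assms by (simp add: chi4_character_def)
  qed
  moreover have "chi4_character (a * b) = chi4_character a * chi4_character b" for a b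
    by (simp add: chi4_character_def chi4_mult)
  ultimately show ?thesis by (simp add: characters_def dirichlet_character_def)
qed

lemma log5_character_ne_1:
  assumes m: "m \<ge> 2" and n4: "[int n = 1] (mod 4)" and n: "\<not> [n = 1] (mod 2 ^ m)"
  shows "log5_character m n \<noteq> 1"
proof
  assume 1: "log5_character m n = 1"
  obtain k where k: "[int n = 5 ^ k] (mod 2 ^ m)" using five_power_representation[OF m n4] by blast
  then have rel: "log5_rel m n k" by (simp add: log5_rel_def)
  have "odd n"
  proof -
    have "[int n = 1] (mod 2)" using n4 by (rule cong_dvd_modulus) simp
    then have "even (int n) \<longleftrightarrow> even (1::int)" by (rule cong_dvd_iff)
    then show ?thesis by simp
  qed
  then have "cis (2 * pi / 2 ^ (m - 2)) ^ k = 1" using 1 log5_character_eq[OF m _ rel] by simp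
  then have "cos (real k * (2 * pi / 2 ^ (m - 2))) = 1" by (metis DeMoivre cis.sel(1) one_complex.sel(1))
  then obtain j :: int where "real k * (2 * pi / 2 ^ (m - 2)) = of_int j * 2 * pi" by (auto simp: cos_one_2pi_int)
  then have "real k = of_int j * 2 ^ (m - 2)" by (simp add: field_simps)
  then have "of_int (int k) = (of_int (j * 2 ^ (m - 2)) :: real)" by simp
  then have "int k = j * 2 ^ (m - 2)" by (simp only: of_int_eq_iff)
  then have "int (2 ^ (m - 2)) dvd int k" by simp
  then have "2 ^ (m - 2) dvd k" by (simp only: int_dvd_int_iff)
  then have "[5 ^ k = 1] (mod (2 ^ m :: int))" using five_power_eq_1_iff[OF m] by blast
  then have "[int n = 1] (mod 2 ^ m)" using k by (rule cong_trans[rotated])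
  then show False using n cong_int_iff[of n 1 "2 ^ m"] by simp
qed

text \<open>
  A class that is 3 modulo 4 is separated from 1 by \<^const>\<open>chi4\<close>. The others are powers of 5, on
  which \<^const>\<open>log5_character\<close> is injective.
\<close>

lemma separated_modulus_two_power:
  assumes m: "m \<ge> 2"
  shows "separated_modulus (2 ^ m)"
proof
  show "(1::nat) < 2 ^ m" using m by (intro one_less_power) auto
next
  fix n :: nat assume n: "coprime n (2 ^ m)" "\<not> [n = 1] (mod 2 ^ m)"
  then have "odd n" using m by simp
  then consider "[int n = 1] (mod 4)" | "[int n = 3] (mod 4)" using odd_cong_4 by blast
  then show "\<exists>\<psi>\<in>characters (2 ^ m). \<psi> n \<noteq> 1"
  proof cases
    case 1
    then show ?thesis using log5_character_ne_1[OF m 1 n(2)] log5_character_is_character[OF m] by blast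
  next
    case 2
    then have "chi4_character n \<noteq> 1" by (simp add: chi4_character_def chi4_def cong_def)
    then show ?thesis using chi4_character_is_character[OF m] by blast
  qed
qed


section \<open>Real characters modulo a power of two\<close>

lemma five_power_mod_8: "(5::int) ^ k mod 8 = (if even k then 1 else 5)"
proof (induction k)
  case (Suc k)
  have "(5::int) ^ Suc k mod 8 = 5 * (5 ^ k mod 8) mod 8" by (simp add: mod_mult_right_eq)
  then show ?case using Suc by simp
qed simp

context
  fixes m :: nat and \<chi> :: "nat \<Rightarrow> complex"
  assumes m: "m \<ge> 2"
    and char: "\<chi> \<in> characters (2 ^ m)"
    and real: "\<And>n. cnj (\<chi> n) = \<chi> n"
begin

interpretation dirichlet_character "2 ^ m" \<chi>
  using char by (simp add: characters_def)

lemma real_character_square: "odd n \<Longrightarrow> \<chi> n * \<chi> n = 1"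
proof -
  assume "odd n"
  then have "norm (\<chi> n) = 1" using norm_eq_1 by simp
  then have "\<chi> n * cnj (\<chi> n) = 1" by (metis complex_norm_square of_real_1 one_power2)
  then show ?thesis by (simp add: real)
qed

text \<open>
  Such an \<open>n\<close> is an even power of 5 and \<open>\<chi>(5)^2 = 1\<close>.
\<close>

lemma real_character_1_mod_8:
  assumes "[n = 1] (mod 8)"
  shows "\<chi> n = 1"
proof -
  have n8: "[int n = 1] (mod 8)" using assms cong_int_iff[of n 1 8] by simp
  then have "[int n = 1] (mod 4)" by (rule cong_dvd_modulus) simp
  \<comment> \<open>The larger modulus is a multiple of 8 even for \<open>m = 2\<close>, so that the parity of \<open>k\<close> can be read
    off modulo 8.\<close>
  then obtain k where k: "[int n = 5 ^ k] (mod 2 ^ (m + 3))"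
    using five_power_representation[of "m + 3"] by auto
  have "(8::int) dvd 2 ^ (m + 3)" by (simp add: power_add)
  then have "[int n = 5 ^ k] (mod 8)" using k cong_dvd_modulus by blast
  then have "even k" using n8 five_power_mod_8[of k] unfolding cong_def by (auto split: if_splits)
  then obtain j where j: "k = 2 * j" by auto
  have "[int n = 5 ^ k] (mod 2 ^ m)"
    using cong_dvd_modulus[OF k, of "2 ^ m"] by (simp add: power_add)
  then have "[n = 5 ^ k] (mod 2 ^ m)" using cong_int_iff[of n "5 ^ k" "2 ^ m"] by simp
  then have "\<chi> n = \<chi> (5 ^ k)" by (rule cong)
  also have "\<dots> = (\<chi> 5 * \<chi> 5) ^ j" by (simp only: power j power_mult power2_eq_square mult)
  also have "\<dots> = 1" using real_character_square[of 5] by simp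
  finally show ?thesis .
qed

lemma real_character_mod_8:
  assumes "odd n" "[n = n'] (mod 8)"
  shows "\<chi> n = \<chi> n'"
proof -
  have "coprime n (2 ^ 3)" by (subst coprime_power_right_iff) (use assms(1) in \<open>simp\<close>)
  then obtain b where b: "[n * b = 1] (mod 8)" using cong_solve_coprime_nat by auto
  have "[n' * b = n * b] (mod 8)" by (rule cong_scalar_right[OF cong_sym[OF assms(2)]])
  then have "[n' * b = 1] (mod 8)" using b by (rule cong_trans)
  then have 1: "\<chi> n' * \<chi> b = 1" "\<chi> n * \<chi> b = 1"
    using b real_character_1_mod_8[of "n' * b"] real_character_1_mod_8[of "n * b"]
    by (simp_all only: mult)
  then have "\<chi> b \<noteq> 0" by auto
  then show ?thesis using 1 by (metis mult_right_cancel)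
qed

end

text \<open>
  A real character is given by the signs at 3, 5 and 7, with \<open>\<chi>(7) = \<chi>(3) * \<chi>(5)\<close> because
  \<open>15 = 7\<close> modulo 8. Excluding the principal one leaves three patterns. In each of them the terms of
  the L-series, taken in blocks of length 8, have nonnegative sums because \<open>1 / x\<close> is decreasing and
  convex, and the first block is positive.
\<close>

lemma real_character_L1_nonzero:
  fixes \<chi> :: "nat \<Rightarrow> complex"
  assumes m: "m \<ge> 2" and char: "\<chi> \<in> characters (2 ^ m)" "\<chi> \<noteq> principal_character (2 ^ m)"
    and real: "\<And>n. cnj (\<chi> n) = \<chi> n"
  shows "nonprincipal_character.L1 \<chi> \<noteq> 0"
proof -
  interpret nonprincipal_character "2 ^ m" \<chi> by (rule nonprincipal_characterI[OF char])
  note mod8 = real_character_mod_8[OF m char(1) real]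
  note sq = real_character_square[OF m char(1) real]
  define r where "r n = Re (\<chi> n)" for n
  have r_eq: "\<chi> n = of_real (r n)" for n
    using real[of n] by (simp add: r_def complex_eq_iff)
  have pm: "r n = 1 \<or> r n = -1" if "odd n" for n
  proof -
    have "r n * r n = 1" using sq[OF that] unfolding r_eq of_real_mult[symmetric] by (simp only: of_real_eq_1_iff)
    then show ?thesis by (simp add: square_eq_1_iff)
  qed
  have r8: "r (8 * k + a) = r a" if "odd a" for k a
  proof -
    have "[8 * k + a = a] (mod 8)" by (simp add: cong_def)
    then have "\<chi> (8 * k + a) = \<chi> a" using that by (intro mod8) auto
    then show ?thesis by (simp only: r_def)
  qed
  have r1: "r 1 = 1" by (simp add: r_def)
  have r7: "r 7 = r 3 * r 5"
  proof -
    have "r 15 = r 7" using r8[of 7 1] by simp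
    moreover have "of_real (r 15) = (of_real (r 3 * r 5) :: complex)"
      using mult[of 3 5] by (simp add: r_eq)
    ultimately show ?thesis by (simp only: of_real_eq_iff)
  qed
  have ev: "r n = 0" if "even n" for n using nonzero_iff[of n] that m by (simp add: r_def)
  have not11: "\<not> (r 3 = 1 \<and> r 5 = 1)"
  proof
    assume 11: "r 3 = 1 \<and> r 5 = 1"
    have "\<chi> n = principal_character (2 ^ m) n" for n
    proof (cases "odd n")
      case True
      then have odd_mod_8: "odd (n mod 8)" by presburger
      from True have "n mod 8 = 1 \<or> n mod 8 = 3 \<or> n mod 8 = 5 \<or> n mod 8 = 7" by presburger
      moreover have "r n = r (n mod 8)" using r8[of "n mod 8" "n div 8"] True by (simp add: odd_mod_8)
      ultimately have "r n = 1" using 11 r1 r7 by (elim disjE) simp_all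
      then show ?thesis using True by (simp add: r_eq principal_character_def)
    next
      case False
      then show ?thesis using ev m by (simp add: r_eq principal_character_def)
    qed
    then show False using char(2) by auto
  qed
  define B where "B k = 1 / (8 * real k + 1) + r 3 / (8 * real k + 3) + r 5 / (8 * real k + 5) + r 7 / (8 * real k + 7)" for k
  have cases: "(r 3 = -1 \<and> r 5 = 1 \<and> r 7 = -1) \<or> (r 3 = -1 \<and> r 5 = -1 \<and> r 7 = 1) \<or> (r 3 = 1 \<and> r 5 = -1 \<and> r 7 = -1)"
    using not11 pm[of 3] pm[of 5] r7 by auto
  have B_nonneg: "B k \<ge> 0" for k
  proof -
    define x where "x = 8 * real k"
    have x: "x \<ge> 0" by (simp add: x_def)
    have d: "1 / (x + 1) \<ge> 1 / (x + 3)" "1 / (x + 3) \<ge> 1 / (x + 5)" "1 / (x + 5) \<ge> 1 / (x + 7)"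
      using x by (intro divide_left_mono; simp)+
    have c: "1 / (x + 1) + 1 / (x + 7) \<ge> 1 / (x + 3) + 1 / (x + 5)"
    proof -
      have "1 / (x + 1) + 1 / (x + 7) = (2 * x + 8) / ((x + 1) * (x + 7))"
           "1 / (x + 3) + 1 / (x + 5) = (2 * x + 8) / ((x + 3) * (x + 5))"
        using x by (simp_all add: add_frac_eq)
      moreover have "(2 * x + 8) / ((x + 3) * (x + 5)) \<le> (2 * x + 8) / ((x + 1) * (x + 7))"
        using x by (intro divide_left_mono mult_pos_pos) (auto simp: algebra_simps)
      ultimately show ?thesis by simp
    qed
    show ?thesis using cases
    proof (elim disjE conjE)
    qed (use d c in \<open>simp_all add: B_def x_def[symmetric]\<close>)
  qed
  \<comment> \<open>The least of the three values, \<open>1 - 1/3 - 1/5 + 1/7\<close>.\<close>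
  have B0: "B 0 \<ge> 64 / 105" using cases unfolding B_def by (elim disjE conjE) simp_all
  have Re_partial: "Re (partial_L1 (8 * K)) = (\<Sum>k<K. B k)" for K
  proof (induction K)
    case (Suc K)
    have p: "Re (partial_L1 (Suc n)) = Re (partial_L1 n) + r (Suc n) / real (Suc n)" for n
      by (simp add: partial_L1_def r_eq)
    have e: "8 * Suc K = Suc (Suc (Suc (Suc (Suc (Suc (Suc (Suc (8 * K))))))))" by simp
    have s: "Suc (8 * K) = 8 * K + 1" "Suc (8 * K + 1) = 8 * K + 2" "Suc (8 * K + 2) = 8 * K + 3"
       "Suc (8 * K + 3) = 8 * K + 4" "Suc (8 * K + 4) = 8 * K + 5" "Suc (8 * K + 5) = 8 * K + 6"
       "Suc (8 * K + 6) = 8 * K + 7" "Suc (8 * K + 7) = 8 * K + 8" by simp_all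
    have "Re (partial_L1 (8 * Suc K)) = Re (partial_L1 (8 * K)) + B K"
      unfolding e p unfolding s using r1 r8[of 1 K] by (simp add: r8 ev B_def)
    then show ?case using Suc by simp
  qed (simp add: partial_L1_def)
  have ge: "Re (partial_L1 (8 * K)) \<ge> 64 / 105" if "K \<ge> 1" for K
  proof -
    have "B 0 \<le> (\<Sum>k<K. B k)" using that B_nonneg by (intro member_le_sum) auto
    then show ?thesis using B0 Re_partial by simp
  qed
  have "(\<lambda>K. partial_L1 (8 * K)) \<longlonglongrightarrow> L1"
    by (rule filterlim_compose[OF partial_L1_tendsto]) (simp add: mult_nat_left_at_top)
  then have "(\<lambda>K. Re (partial_L1 (8 * K))) \<longlonglongrightarrow> Re L1" by (rule tendsto_Re)
  then have "Re L1 \<ge> 64 / 105" by (rule LIMSEQ_le_const) (use ge in blast)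
  then show ?thesis by auto
qed

theorem mertens_progression_two_power:
  assumes "m \<ge> 2" "odd a"
  shows "\<exists>C. \<forall>N>0. \<bar>(\<Sum>n | n \<in> {1..N} \<and> [n = a] (mod 2 ^ m). mangoldt n / real n)
    - ln (real N) / real (totient (2 ^ m))\<bar> \<le> C"
proof -
  interpret separated_modulus "2 ^ m" by (rule separated_modulus_two_power[OF assms(1)])
  show ?thesis
  proof (rule mertens_progression)
    fix \<chi> assume \<chi>: "\<chi> \<in> characters (2 ^ m)" "\<chi> \<noteq> principal_character (2 ^ m)"
    show "nonprincipal_character.L1 \<chi> \<noteq> 0"
      using real_character_L1_nonzero[OF assms(1) \<chi>] L1_zero_imp_real[OF \<chi>] by blast
  qed (use assms in \<open>simp\<close>)
qed

section \<open>From logarithmic weights to reciprocals of primes\<close>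

text \<open>
  The sum is a Riemann sum for the integral of \<open>1 / t\<close> with \<open>t = ln n\<close>, and \<open>ln (ln N)\<close> is that
  integral up to a constant. The difference decreases, by amounts with a telescoping bound.
\<close>

lemma sum_ln_increments_convergent:
  "\<exists>L. (\<lambda>N. (\<Sum>n=2..N. (ln (real n) - ln (real (n - 1))) / ln (real n)) - ln (ln (real N))) \<longlonglongrightarrow> L"
proof -
  define V where "V N = (\<Sum>n=2..N. (ln (real n) - ln (real (n - 1))) / ln (real n)) - ln (ln (real N))" for N
  have step: "V (Suc n) \<le> V n \<and> V n - V (Suc n) \<le> 1 / ln (real n) - 1 / ln (real (Suc n))"
    if n: "n \<ge> 2" for n
  proof -
    define x y where "x = ln (real (Suc n))" and "y = ln (real n)"
    have y: "y > 0" using n by (simp add: y_def)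
    have xy: "y \<le> x" using n by (simp add: x_def y_def)
    have "x - y = ln (1 + 1 / real n)"
      using n unfolding x_def y_def by (subst ln_divide_pos[symmetric]) (auto simp: field_simps)
    also have "\<dots> \<le> 1 / real n" using n by (intro ln_add_one_self_le_self) auto
    also have "\<dots> \<le> 1" using n by simp
    finally have d: "x - y \<le> 1" .
    have diff: "V (Suc n) - V n = (x - y) / x - ln (x / y)"
      using n y xy by (simp add: V_def x_def y_def ln_div del: of_nat_Suc)
    have "ln (y / x) \<le> y / x - 1" using y xy by (intro ln_le_minus_one) auto
    moreover have "ln (y / x) = - ln (x / y)" using y xy by (simp add: ln_div)
    moreover have "(x - y) / x = 1 - y / x" using y xy by (simp add: diff_divide_distrib)
    ultimately have 1: "V (Suc n) \<le> V n" using diff by linarith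
    have "ln (x / y) \<le> x / y - 1" using y xy by (intro ln_le_minus_one) auto
    also have "\<dots> = (x - y) / y" using y by (simp add: diff_divide_distrib)
    finally have "V n - V (Suc n) \<le> (x - y) * (1 / y - 1 / x)"
      using diff by (simp add: right_diff_distrib)
    also have "\<dots> \<le> 1 * (1 / y - 1 / x)"
      using d y xy by (intro mult_right_mono) (auto simp: frac_le)
    finally show ?thesis using 1 by (simp add: x_def y_def)
  qed
  \<comment> \<open>The sequence starts at 2, where \<open>ln (ln N)\<close> becomes meaningful.\<close>
  have "decseq (\<lambda>k. V (k + 2))" by (rule decseq_SucI) (use step in simp)
  moreover have "V 2 - 1 / ln 2 \<le> V (k + 2)" for k
  proof -
    have "V 2 - V (k + 2) \<le> 1 / ln 2 - 1 / ln (real (k + 2))"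
    proof (induction k)
      case (Suc k)
      then show ?case using step[of "k + 2"] by simp
    qed (simp add: numeral_2_eq_2)
    moreover have "1 / ln (real (k + 2)) \<ge> 0" by simp
    ultimately show ?thesis by linarith
  qed
  ultimately obtain L where "(\<lambda>k. V (k + 2)) \<longlonglongrightarrow> L"
    using decseq_convergent[of "\<lambda>k. V (k + 2)"] by blast
  then have "V \<longlonglongrightarrow> L" by (rule LIMSEQ_offset)
  then show ?thesis unfolding V_def by blast
qed

text \<open>
  Subtracting \<open>\<alpha>\<close> times the increments of \<open>ln\<close> from \<open>c\<close> leaves bounded partial sums, so that
  dividing by \<open>ln n\<close> gives a convergent series by \<open>abel_tail_bound\<close>. The subtracted part is
  the content of \<open>sum_ln_increments_convergent\<close>.
\<close>

theorem partial_summation_ln: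
  fixes c :: "nat \<Rightarrow> real"
  assumes bound: "\<And>N. N > 0 \<Longrightarrow> \<bar>(\<Sum>n=1..N. c n) - \<alpha> * ln (real N)\<bar> \<le> C"
  shows "\<exists>L. (\<lambda>N. (\<Sum>n=2..N. c n / ln (real n)) - \<alpha> * ln (ln (real N))) \<longlonglongrightarrow> L"
proof -
  \<comment> \<open>The increment at 1 is 0 because of the convention \<open>ln 0 = 0\<close>, which is what makes the sum of
    the increments up to \<open>N\<close> equal to \<open>ln N\<close>.\<close>
  define a where "a n = (if n = 0 then 0 else c n - \<alpha> * (ln (real n) - ln (real (n - 1))))" for n
  have sum_a: "(\<Sum>n<Suc N. a n) = (\<Sum>n=1..N. c n) - \<alpha> * ln (real N)" for N
    by (induction N) (auto simp: a_def algebra_simps)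
  have C0: "C \<ge> 0" using bound[of 1] by simp
  have sum_bound: "norm (\<Sum>n<N. a n) \<le> C" for N
  proof (cases "N \<le> 1")
    case True
    then have "N = 0 \<or> N = 1" by auto
    then show ?thesis using C0 by (auto simp: a_def)
  next
    case False
    then obtain M where "N = Suc M" "M > 0" by (cases N) auto
    then show ?thesis using bound[of M] sum_a[of M] by simp
  qed
  define T where "T N = (\<Sum>n=2..N. a n / ln (real n))" for N
  have T_diff: "norm (T N - T M) \<le> 2 * C / ln (real (Suc M))" if "M \<le> N" "M \<ge> 1" for M N
  proof -
    have "{2..N} = {2..M} \<union> {Suc M..<Suc N}" using that by auto
    then have "T N = T M + (\<Sum>n=Suc M..<Suc N. a n / ln (real n))"
      unfolding T_def by (simp only:, subst sum.union_disjoint) auto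
    then have "T N - T M = (\<Sum>n=Suc M..<Suc N. a n * of_real (1 / ln (real n)))" by simp
    also have "norm \<dots> \<le> 2 * C * (1 / ln (real (Suc M)))"
    proof (rule abel_tail_bound[OF sum_bound])
      fix n assume "Suc M \<le> n"
      then have "n \<ge> 2" using that by simp
      then show "1 / ln (real (Suc n)) \<le> 1 / ln (real n)" by (intro divide_left_mono) auto
    qed (use that in auto)
    finally show ?thesis by simp
  qed
  have "Cauchy T"
  proof (rule metric_CauchyI)
    fix e :: real assume e: "e > 0"
    obtain K where K: "exp (2 * C / e) < real K" using reals_Archimedean2 by blast
    have *: "dist (T m) (T n) < e" if "m \<ge> n" "n \<ge> max 1 K" for m n
    proof -
      have n: "exp (2 * C / e) < real (Suc n)" using K that by simp
      then have "ln (exp (2 * C / e)) < ln (real (Suc n))" by (subst ln_less_cancel_iff) auto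
      then have "2 * C / e < ln (real (Suc n))" by simp
      moreover have "ln (real (Suc n)) > 0" using that by (intro ln_gt_zero) auto
      ultimately have "2 * C / ln (real (Suc n)) < e" using e by (simp add: field_simps)
      then show ?thesis using T_diff[of n m] that by (simp add: dist_norm)
    qed
    show "\<exists>M. \<forall>m\<ge>M. \<forall>n\<ge>M. dist (T m) (T n) < e"
      using * by (metis dist_commute nle_le)
  qed
  then obtain L1 where L1: "T \<longlonglongrightarrow> L1" by (meson Cauchy_convergent convergentD)
  obtain L2 where L2: "(\<lambda>N. (\<Sum>n=2..N. (ln (real n) - ln (real (n - 1))) / ln (real n)) - ln (ln (real N))) \<longlonglongrightarrow> L2"
    using sum_ln_increments_convergent by blast
  have "(\<lambda>N. T N + \<alpha> * ((\<Sum>n=2..N. (ln (real n) - ln (real (n - 1))) / ln (real n)) - ln (ln (real N))))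
      \<longlonglongrightarrow> L1 + \<alpha> * L2"
    by (intro tendsto_intros L1 L2)
  also have "(\<lambda>N. T N + \<alpha> * ((\<Sum>n=2..N. (ln (real n) - ln (real (n - 1))) / ln (real n)) - ln (ln (real N))))
      = (\<lambda>N. (\<Sum>n=2..N. c n / ln (real n)) - \<alpha> * ln (ln (real N)))"
  proof
    fix N
    have "(\<Sum>n=2..N. c n / ln (real n))
        = (\<Sum>n=2..N. a n / ln (real n) + \<alpha> * ((ln (real n) - ln (real (n - 1))) / ln (real n)))"
      by (intro sum.cong) (auto simp: a_def diff_divide_distrib right_diff_distrib)
    also have "\<dots> = T N + \<alpha> * (\<Sum>n=2..N. (ln (real n) - ln (real (n - 1))) / ln (real n))"
      by (simp only: T_def sum.distrib sum_distrib_left)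
    finally show "T N + \<alpha> * ((\<Sum>n=2..N. (ln (real n) - ln (real (n - 1))) / ln (real n)) - ln (ln (real N)))
      = (\<Sum>n=2..N. c n / ln (real n)) - \<alpha> * ln (ln (real N))"
      by (simp add: right_diff_distrib)
  qed
  finally show ?thesis by blast
qed

text \<open>
  Partial summation applied to \<open>ln p / p\<close> on the primes of the class. Passing from \<open>\<Lambda>\<close> to the
  primes costs only the bounded sum over proper prime powers.
\<close>

theorem mertens_second_progression:
  assumes "m \<ge> 2" "odd a"
  shows "\<exists>L. (\<lambda>N. (\<Sum>p | p \<in> {1..N} \<and> prime p \<and> [p = a] (mod 2 ^ m). 1 / real p)
      - ln (ln (real N)) / real (totient (2 ^ m))) \<longlonglongrightarrow> L"
proof -
  obtain C where C: "\<And>N. N > 0 \<Longrightarrow> \<bar>(\<Sum>n | n \<in> {1..N} \<and> [n = a] (mod 2 ^ m). mangoldt n / real n)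
    - ln (real N) / real (totient (2 ^ m))\<bar> \<le> C"
    using mertens_progression_two_power[OF assms] by blast
  define c where "c n = (if prime n \<and> [n = a] (mod 2 ^ m) then ln (real n) / real n else 0)" for n
  have "\<bar>(\<Sum>n=1..N. c n) - 1 / real (totient (2 ^ m)) * ln (real N)\<bar> \<le> C + 2" if N: "N > 0" for N
  proof -
    define U where "U = (\<Sum>n | n \<in> {1..N} \<and> [n = a] (mod 2 ^ m). mangoldt n / real n :: real)"
    define D where "D = (\<Sum>n | n \<in> {1..N} \<and> [n = a] (mod 2 ^ m) \<and> \<not> prime n. mangoldt n / real n :: real)"
    have "(\<Sum>n=1..N. c n) = (\<Sum>n | n \<in> {1..N} \<and> [n = a] (mod 2 ^ m) \<and> prime n. mangoldt n / real n)"
      unfolding c_def by (intro sum.mono_neutral_cong_right) auto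
    moreover have "U = (\<Sum>n | n \<in> {1..N} \<and> [n = a] (mod 2 ^ m) \<and> prime n. mangoldt n / real n) + D"
      unfolding U_def D_def
      by (subst sum.union_disjoint[symmetric])
         (auto intro!: arg_cong[where f = "sum (\<lambda>n. mangoldt n / real n)"])
    ultimately have "(\<Sum>n=1..N. c n) = U - D" by simp
    moreover have "0 \<le> D" unfolding D_def by (intro sum_nonneg) (simp add: mangoldt_nonneg)
    moreover have "D \<le> (\<Sum>n | n \<in> {1..N} \<and> \<not> prime n. mangoldt n / real n)"
      unfolding D_def by (intro sum_mono2) (auto simp: mangoldt_nonneg)
    moreover have "\<bar>U - ln (real N) / real (totient (2 ^ m))\<bar> \<le> C" using C[OF N] by (simp only: U_def)
    ultimately show ?thesis using sum_mangoldt_nonprime_bounded[of N] by simp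
  qed
  then obtain L where L: "(\<lambda>N. (\<Sum>n=2..N. c n / ln (real n)) - 1 / real (totient (2 ^ m)) * ln (ln (real N))) \<longlonglongrightarrow> L"
    using partial_summation_ln[of c "1 / real (totient (2 ^ m))" "C + 2"] by blast
  have "(\<Sum>n=2..N. c n / ln (real n)) = (\<Sum>p | p \<in> {1..N} \<and> prime p \<and> [p = a] (mod 2 ^ m). 1 / real p)" for N
  proof (rule sum.mono_neutral_cong_right)
    show "{p. p \<in> {1..N} \<and> prime p \<and> [p = a] (mod 2 ^ m)} \<subseteq> {2..N}" using prime_ge_2_nat by auto
    fix p assume "p \<in> {p. p \<in> {1..N} \<and> prime p \<and> [p = a] (mod 2 ^ m)}"
    then have p: "prime p" "[p = a] (mod 2 ^ m)" by auto
    then have "ln (real p) > 0" using prime_gt_1_nat by (intro ln_gt_zero) auto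
    then show "c p / ln (real p) = 1 / real p" using p by (simp add: c_def)
  qed (auto simp: c_def)
  then show ?thesis using L by auto
qed


section \<open>The product over primes\<close>

lemma ln_quotient_expansion:
  fixes t :: real
  assumes "\<bar>t\<bar> \<le> 1 / 2"
  shows "\<bar>ln ((1 - t) / (1 + t)) + 2 * t\<bar> \<le> 4 * t\<^sup>2"
proof -
  have "ln ((1 - t) / (1 + t)) = ln (1 + - t) - ln (1 + t)"
  proof -
    have "1 - t > 0" "1 + t > 0" using assms by linarith+
    then show ?thesis by (simp add: ln_div)
  qed
  then show ?thesis
    using abs_ln_one_plus_x_minus_x_bound[of t] abs_ln_one_plus_x_minus_x_bound[of "-t"] assms
    by simp
qed

lemma abs_chi4_le: "\<bar>chi4 n\<bar> \<le> 1"
  by (simp add: chi4_def)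

lemma prime_quot_expansion:
  assumes "p \<ge> 2"
  shows "prime_quot p > 0"
    and "\<bar>ln (prime_quot p) + 2 * of_int (chi4 (int p)) / real p\<bar> \<le> 4 * (1 / real p)\<^sup>2"
proof -
  define s where "s = real_of_int (chi4 (int p))"
  define t where "t = s / real p"
  have s: "\<bar>s\<bar> \<le> 1" using abs_chi4_le[of "int p"] unfolding s_def by linarith
  have p: "real p \<ge> 2" using assms by simp
  have abs_t: "\<bar>t\<bar> \<le> 1 / real p" using s p by (simp add: t_def divide_right_mono)
  also have "\<dots> \<le> 1 / 2" using p by (simp add: field_simps)
  finally have t: "\<bar>t\<bar> \<le> 1 / 2" .
  have "prime_quot p = (real p * (1 - t)) / (real p * (1 + t))"
    using p by (simp add: prime_quot_def t_def s_def algebra_simps)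
  then have eq: "prime_quot p = (1 - t) / (1 + t)" using p by simp
  then show "prime_quot p > 0" using t by (auto simp: abs_le_iff)
  have "t\<^sup>2 \<le> (1 / real p)\<^sup>2" using abs_t by (metis abs_ge_zero power2_abs power_mono)
  then show "\<bar>ln (prime_quot p) + 2 * of_int (chi4 (int p)) / real p\<bar> \<le> 4 * (1 / real p)\<^sup>2"
    using ln_quotient_expansion[OF t] unfolding eq by (simp add: t_def s_def)
qed

lemma summable_inverse_square: "summable (\<lambda>n. (1 / real n)\<^sup>2)"
proof (rule bounded_imp_summable)
  have bound: "(\<Sum>k\<le>Suc n. (1 / real k)\<^sup>2) \<le> 2 - 1 / real (Suc n)" for n
  proof (induction n)
    case (Suc n)
    have "(1 / real (Suc (Suc n)))\<^sup>2 \<le> 1 / (real (Suc n) * real (Suc (Suc n)))"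
      unfolding power2_eq_square times_divide_times_eq
      by (intro frac_le mult_right_mono) auto
    also have "\<dots> = 1 / real (Suc n) - 1 / real (Suc (Suc n))"
      by (simp add: field_simps)
    finally show ?case using Suc by (simp del: of_nat_Suc)
  qed simp
  show "(\<Sum>k\<le>n. (1 / real k)\<^sup>2) \<le> 2" for n
  proof (cases n)
    case (Suc m)
    have "1 / real (Suc m) \<ge> 0" by simp
    then show ?thesis using bound[of m] unfolding Suc by linarith
  qed simp
qed simp

text \<open>
  The primes are sorted by their class in \<open>S\<close>. On the class of \<open>a\<close> the character is constantly
  \<open>chi4 a\<close>, so \<^const>\<open>mu\<close> appears when the coefficients of \<open>ln (ln N)\<close> are collected. What
  remains of each logarithm is \<open>O(1 / p^2)\<close>, hence summable.
\<close>

lemma ln_P_prod_asymptotics: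
  fixes q m :: nat and S :: "int set"
  assumes m: "m \<ge> 2" and q: "q = 2 ^ m" and S: "S \<subseteq> Units (residue_ring (int q))"
  shows "\<exists>L. (\<lambda>N. ln (P_prod q S (real N)) - (- 2 * of_int (mu S) / of_nat (totient q)) * ln (ln (real N))) \<longlonglongrightarrow> L"
proof -
  have q2: "int q > 1" using m q by simp
  have even_q: "even q" using m q by simp
  have S_odd: "odd a \<and> 0 \<le> a \<and> a < int q" if "a \<in> S" for a
  proof -
    interpret residues "int q" "residue_ring (int q)" using q2 by unfold_locales auto
    have "a \<in> {0 <..< int q}" "coprime a (int q)" using S that unfolding res_units_eq by auto
    then show ?thesis using even_q by (auto dest: coprime_common_divisor)
  qed
  have finS: "finite S" by (rule finite_subset[of _ "{0..<int q}"]) (use S_odd in auto)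
  define A where "A N = {p. prime p \<and> odd p \<and> real p \<le> real N \<and> int p mod int q \<in> S}" for N
  define e where "e p = ln (prime_quot p) + 2 * of_int (chi4 (int p)) / real p" for p
  have finA: "finite (A N)" for N
    by (rule finite_subset[of _ "{..N}"]) (auto simp: A_def)
  have ln_P: "ln (P_prod q S (real N)) = (\<Sum>p\<in>A N. e p) - 2 * (\<Sum>p\<in>A N. of_int (chi4 (int p)) / real p)" for N
  proof -
    have "ln (P_prod q S (real N)) = (\<Sum>p\<in>A N. ln (prime_quot p))"
      unfolding P_prod_def A_def[symmetric]
    proof (rule ln_prod)
      fix p assume "p \<in> A N"
      then have "prime_quot p > 0"
        by (auto simp: A_def intro!: prime_quot_expansion(1) prime_ge_2_nat)
      then show "prime_quot p \<noteq> 0" by simp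
    qed (rule finA)
    then show ?thesis by (simp add: e_def sum.distrib sum_distrib_left)
  qed
  have conv_e: "\<exists>L. (\<lambda>N. \<Sum>p\<in>A N. e p) \<longlonglongrightarrow> L"
  proof -
    define f where "f p = (if prime p \<and> odd p \<and> int p mod int q \<in> S then e p else 0)" for p
    have "summable (\<lambda>p. 4 * (1 / real p) ^ 2)"
      by (intro summable_mult summable_inverse_square)
    moreover have "norm (f p) \<le> 4 * (1 / real p) ^ 2" for p
      using prime_quot_expansion(2)[of p] prime_ge_2_nat[of p] by (auto simp: f_def e_def)
    ultimately have "summable f" by (rule summable_comparison_test')
    then have "(\<lambda>N. \<Sum>p<Suc N. f p) \<longlonglongrightarrow> suminf f"
      by (intro LIMSEQ_Suc summable_LIMSEQ)
    moreover have "(\<Sum>p<Suc N. f p) = (\<Sum>p\<in>A N. e p)" for N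
      unfolding f_def by (intro sum.mono_neutral_cong_right) (auto simp: A_def)
    ultimately show ?thesis by auto
  qed
  then obtain L0 where L0: "(\<lambda>N. \<Sum>p\<in>A N. e p) \<longlonglongrightarrow> L0" by blast
  define R where "R a N = (\<Sum>p | p \<in> {1..N} \<and> prime p \<and> [p = nat a] (mod 2 ^ m). 1 / real p)" for a N
  have "\<forall>a\<in>S. \<exists>L. (\<lambda>N. R a N - ln (ln (real N)) / real (totient (2 ^ m))) \<longlonglongrightarrow> L"
    unfolding R_def using S_odd by (intro ballI mertens_second_progression m) (simp add: even_nat_iff)
  then obtain L where L: "\<And>a. a \<in> S \<Longrightarrow> (\<lambda>N. R a N - ln (ln (real N)) / real (totient (2 ^ m))) \<longlonglongrightarrow> L a"
    by metis
  have split: "(\<Sum>p\<in>A N. of_int (chi4 (int p)) / real p) = (\<Sum>a\<in>S. of_int (chi4 a) * R a N)" for N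
  proof -
    have "(\<Sum>p\<in>A N. of_int (chi4 (int p)) / real p)
        = (\<Sum>a\<in>S. \<Sum>p | p \<in> A N \<and> int p mod int q = a. of_int (chi4 (int p)) / real p)"
      by (rule sum.group[symmetric]) (use finA finS in \<open>auto simp: A_def\<close>)
    also have "\<dots> = (\<Sum>a\<in>S. of_int (chi4 a) * R a N)"
    proof (intro sum.cong refl, goal_cases)
      case (1 a)
      have a: "odd a" "0 \<le> a" "a < int q" using S_odd[OF 1] by auto
      have in_class: "int p mod int q = a \<longleftrightarrow> [p = nat a] (mod 2 ^ m)" for p
        using a cong_int_iff[of p "nat a" q] by (simp add: cong_def q)
      have odd_class: "odd p" if "int p mod int q = a" for p
      proof
        assume "even p"
        then have "even (int p mod int q)" using even_q by (simp add: dvd_mod_iff)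
        then show False using that a by simp
      qed
      have chi: "chi4 (int p) = chi4 a" if "int p mod int q = a" for p
      proof -
        have "(4::int) dvd int q" using le_imp_power_dvd[OF m, of "2::int"] q by simp
        then have "int p mod 4 = a mod 4" unfolding that[symmetric] by (simp add: mod_mod_cancel)
        then show ?thesis by (metis chi4_mod)
      qed
      have "{p. p \<in> A N \<and> int p mod int q = a} = {p. p \<in> {1..N} \<and> prime p \<and> [p = nat a] (mod 2 ^ m)}"
        using 1 odd_class by (auto simp: A_def in_class[symmetric] Suc_le_eq prime_gt_0_nat)
      then show ?case unfolding R_def sum_distrib_left in_class[symmetric]
        by (intro sum.cong) (auto simp: chi)
    qed
    finally show ?thesis .
  qed
  have "(\<lambda>N. (\<Sum>p\<in>A N. e p) - 2 * (\<Sum>a\<in>S. of_int (chi4 a) * (R a N - ln (ln (real N)) / real (totient (2 ^ m)))))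
     \<longlonglongrightarrow> L0 - 2 * (\<Sum>a\<in>S. of_int (chi4 a) * L a)"
    by (intro tendsto_intros L0 L)
  also have "(\<lambda>N. (\<Sum>p\<in>A N. e p) - 2 * (\<Sum>a\<in>S. of_int (chi4 a) * (R a N - ln (ln (real N)) / real (totient (2 ^ m)))))
     = (\<lambda>N. ln (P_prod q S (real N)) - (- 2 * of_int (mu S) / of_nat (totient q)) * ln (ln (real N)))"
  proof
    fix N
    have "(\<Sum>a\<in>S. of_int (chi4 a) * (R a N - ln (ln (real N)) / real (totient (2 ^ m))))
        = (\<Sum>a\<in>S. of_int (chi4 a) * R a N) - of_int (mu S) * (ln (ln (real N)) / real (totient q))"
      by (simp only: right_diff_distrib sum_subtractf mu_def of_int_sum sum_distrib_right q)
    then show "(\<Sum>p\<in>A N. e p) - 2 * (\<Sum>a\<in>S. of_int (chi4 a) * (R a N - ln (ln (real N)) / real (totient (2 ^ m))))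
       = ln (P_prod q S (real N)) - (- 2 * of_int (mu S) / of_nat (totient q)) * ln (ln (real N))"
      by (simp add: ln_P split right_diff_distrib)
  qed
  finally show ?thesis by blast
qed

text \<open>
  The product changes only at integers while the asymptotic formula is stated for real \<open>x\<close>; this
  bridges the gap.
\<close>

lemma ln_ln_floor_tendsto: "((\<lambda>x. ln (ln (real (nat \<lfloor>x\<rfloor>))) - ln (ln x)) \<longlongrightarrow> 0) at_top"
proof (rule tendsto_sandwich)
  \<comment> \<open>From 9 on, \<open>ln x \<ge> 2\<close>, since \<open>e \<le> 3\<close>; so the lower bound \<open>ln x - 1\<close> for the logarithm of the
    floor is positive.\<close>
  have bounds: "- (1 / (ln x - 1)) \<le> ln (ln (real (nat \<lfloor>x\<rfloor>))) - ln (ln x) \<and> ln (ln (real (nat \<lfloor>x\<rfloor>))) - ln (ln x) \<le> 0"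
    if x: "x \<ge> 9" for x :: real
  proof -
    define n where "n = real (nat \<lfloor>x\<rfloor>)"
    have n: "n \<le> x" "n \<ge> x - 1" "n \<ge> 8" using x unfolding n_def by linarith+
    have e: "exp (1::real) \<le> 3" by (rule exp_le)
    have "x \<le> exp 1 * n"
    proof -
      have "exp (1::real) \<ge> 2" using exp_ge_add_one_self[of 1] by simp
      then have "2 * n \<le> exp 1 * n" using n by (intro mult_right_mono) auto
      then show ?thesis using n by linarith
    qed
    then have "ln x \<le> ln (exp 1 * n)" using x n by (subst ln_le_cancel_iff) auto
    then have lo: "ln x - 1 \<le> ln n" using n by (simp add: ln_mult)
    have hi: "ln n \<le> ln x" using n by simp
    have "ln x \<ge> 2"
    proof -
      have "exp (2::real) = exp 1 * exp 1" by (simp flip: exp_add)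
      also have "\<dots> \<le> 3 * 3" using e by (intro mult_mono) auto
      finally show ?thesis using x by (subst ln_ge_iff) auto
    qed
    then have pos: "ln x - 1 > 0" "ln n > 0" using lo by auto
    have "ln (ln x) - ln (ln n) = ln (ln x / ln n)" using pos by (simp add: ln_div)
    also have "\<dots> \<le> ln x / ln n - 1" using pos by (intro ln_le_minus_one) auto
    also have "\<dots> = (ln x - ln n) / ln n" using pos by (simp add: diff_divide_distrib)
    also have "\<dots> \<le> 1 / (ln x - 1)" using pos lo hi by (intro frac_le) auto
    finally have "- (1 / (ln x - 1)) \<le> ln (ln n) - ln (ln x)" by simp
    moreover have "ln (ln n) \<le> ln (ln x)" using pos hi by simp
    ultimately show ?thesis by (simp add: n_def)
  qed
  show "\<forall>\<^sub>F x in at_top. - (1 / (ln x - 1)) \<le> ln (ln (real (nat \<lfloor>x\<rfloor>))) - ln (ln x)"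
    using eventually_ge_at_top[of 9] by eventually_elim (use bounds in blast)
  show "\<forall>\<^sub>F x in at_top. ln (ln (real (nat \<lfloor>x\<rfloor>))) - ln (ln x) \<le> 0"
    using eventually_ge_at_top[of 9] by eventually_elim (use bounds in blast)
  have "filterlim (\<lambda>x::real. - 1 + ln x) at_top at_top"
    by (rule filterlim_tendsto_add_at_top[OF tendsto_const ln_at_top])
  then have "((\<lambda>x::real. - (1 / (- 1 + ln x))) \<longlongrightarrow> - 0) at_top"
    by (intro tendsto_minus tendsto_divide_0[OF tendsto_const] filterlim_at_top_imp_at_infinity)
  then show "((\<lambda>x::real. - (1 / (ln x - 1))) \<longlongrightarrow> 0) at_top" by simp
qed (rule tendsto_const)

theorem theorem1:
  fixes q m :: nat and S :: "int set"
  assumes "m \<ge> 2" and "q = 2 ^ m"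
    and "S \<subseteq> Units (residue_ring (int q))"
  shows "\<exists>K::real. K > 0 \<and>
    (\<exists>\<epsilon> :: real \<Rightarrow> real. \<epsilon> \<in> o[at_top](\<lambda>_. 1) \<and>
      (\<forall>\<^sub>F x in at_top. P_prod q S x =
        K * (ln x) powr (- 2 * of_int (mu S) / of_nat (totient q)) * (1 + \<epsilon> x)))"
proof -
  define \<beta> where "\<beta> = (- 2 * of_int (mu S) / of_nat (totient q) :: real)"
  obtain L where L: "(\<lambda>N. ln (P_prod q S (real N)) - \<beta> * ln (ln (real N))) \<longlonglongrightarrow> L"
    using ln_P_prod_asymptotics[OF assms] unfolding \<beta>_def by blast
  have P_pos: "P_prod q S x > 0" for x
    unfolding P_prod_def by (intro prod_pos) (auto intro!: prime_quot_expansion(1) prime_ge_2_nat)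
  have P_floor: "P_prod q S (real (nat \<lfloor>x\<rfloor>)) = P_prod q S x" if "x \<ge> 0" for x
  proof -
    have "real p \<le> real (nat \<lfloor>x\<rfloor>) \<longleftrightarrow> real p \<le> x" for p
    proof -
      have "real p \<le> real (nat \<lfloor>x\<rfloor>) \<longleftrightarrow> int p \<le> \<lfloor>x\<rfloor>"
        using that by (simp only: of_nat_le_iff) (simp add: le_nat_iff)
      then show ?thesis using le_floor_iff[of "int p" x] by simp
    qed
    then show ?thesis by (simp only: P_prod_def)
  qed
  define D where "D x = ln (P_prod q S x) - \<beta> * ln (ln x) - L" for x
  have "((\<lambda>x. (ln (P_prod q S (real (nat \<lfloor>x\<rfloor>))) - \<beta> * ln (ln (real (nat \<lfloor>x\<rfloor>)))) - L
      + \<beta> * (ln (ln (real (nat \<lfloor>x\<rfloor>))) - ln (ln x))) \<longlongrightarrow> L - L + \<beta> * 0) at_top"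
    by (intro tendsto_intros ln_ln_floor_tendsto filterlim_compose[OF L]
          filterlim_compose[OF filterlim_nat_sequentially filterlim_floor_sequentially])
  then have "((\<lambda>x. (ln (P_prod q S (real (nat \<lfloor>x\<rfloor>))) - \<beta> * ln (ln (real (nat \<lfloor>x\<rfloor>)))) - L
      + \<beta> * (ln (ln (real (nat \<lfloor>x\<rfloor>))) - ln (ln x))) \<longlongrightarrow> 0) at_top" by simp
  then have "(D \<longlongrightarrow> 0) at_top"
  proof (rule Lim_transform_eventually)
    show "\<forall>\<^sub>F x in at_top. (ln (P_prod q S (real (nat \<lfloor>x\<rfloor>))) - \<beta> * ln (ln (real (nat \<lfloor>x\<rfloor>)))) - L
        + \<beta> * (ln (ln (real (nat \<lfloor>x\<rfloor>))) - ln (ln x)) = D x"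
      using eventually_ge_at_top[of 0]
    proof eventually_elim
      case (elim x)
      show ?case unfolding P_floor[OF elim] D_def by (simp add: right_diff_distrib)
    qed
  qed
  then have "((\<lambda>x. exp (D x) - 1) \<longlongrightarrow> exp 0 - 1) at_top" by (intro tendsto_intros)
  then have small: "(\<lambda>x. exp (D x) - 1) \<in> o[at_top](\<lambda>_. 1)"
    by (intro smalloI_tendsto) auto
  have "\<forall>\<^sub>F x in at_top. P_prod q S x = exp L * (ln x) powr \<beta> * (1 + (exp (D x) - 1))"
    using eventually_gt_at_top[of 1]
  proof eventually_elim
    case (elim x)
    then have "ln x > 0" by simp
    then have "exp L * (ln x) powr \<beta> * (1 + (exp (D x) - 1)) = exp (L + \<beta> * ln (ln x) + D x)"
      by (simp add: powr_def exp_add)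
    also have "\<dots> = P_prod q S x" using P_pos by (simp add: D_def)
    finally show ?case by simp
  qed
  then show ?thesis using small unfolding \<beta>_def by (intro exI[of _ "exp L"] conjI exI[of _ "\<lambda>x. exp (D x) - 1"]) auto
qed

end
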